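(* For each positive real number $c$, let $(b_k)_{k\ge 0}$ be the sequence of functions of $y$ uniquely determined by $c$ through the recursion given in the context. Then the formal power series $$f(x,y)=y+c\,y\,x^3+\sum_{k=4}^\infty \frac{b_k(y)}{k}x^k$$ gives a real analytic zero mean curvature surface on a neighborhood of $(x,y)=(0,0)$; that is, the series converges to a real analytic function $f$ on a neighborhood of $(0,0)$ in $\mathbb{R}^2$ which satisfies there the zero mean curvature equation $$(1-f_y^2)f_{xx}+2f_xf_yf_{xy}+(1-f_x^2)f_{yy}=0 .$$ In particular, there exists a non-trivial $1$-parameter family of real analytic zero mean curvature surfaces in $\mathbb{R}^3_1$ (obtained by varying $c>0$), each of which changes type across a light-like line, namely the line $\{t=y,\ x=0\}$.
   Context: $\mathbb{R}^3_1$ is Lorentz-Minkowski $3$-space with coordinates $(t,x,y)$ and metric of signature $(-,+,+)$, i.e. $-dt^2+dx^2+dy^2$. A zero mean curvature surface here is (locally) the graph $t=f(x,y)$ of a function satisfying $(1-f_y^2)f_{xx}+2f_xf_yf_{xy}+(1-f_x^2)f_{yy}=0$, subscripts denoting partial derivatives. The graph is space-like where $1-f_x^2-f_y^2>0$, time-like where $1-f_x^2-f_y^2<0$, and degenerate (light-like) where $1-f_x^2-f_y^2=0$. A light-like line is a straight line (or, locally, a segment of it) whose direction vector is non-zero and null for the metric. The graph changes type across the light-like line $\{t=y,\ x=0\}$ if it contains (a segment of) this line and $1-f_x^2-f_y^2$ changes sign across it, so that the surface is space-like on one side and time-like on the other. The $1$-parameter family is the family of graphs of $f$ as $c$ ranges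 over the positive reals; non-trivial means that the surface really depends on the parameter $c$. Recursion defining $b_k$: $b_0(y)=y$, $b_1(y)=0$, $b_2(y)=0$, $b_3(y)=3c\,y$, and for $k\ge 4$, $$b''_k(y)=-k\,(P_k+Q_k-R_k),\qquad b_k(0)=b'_k(0)=0,$$ where $'=d/dy$, $$P_k=\sum_{m=3}^{k-1}\frac{2(k-2m+3)}{k-m+2}\,b_m(y)\,b'_{k-m+2}(y)\qquad(k\ge 4),$$ $$Q_k=\sum_{m=3}^{k-4}\sum_{n=3}^{k-m-1}\frac{3n-k+m-1}{mn}\,b'_m(y)\,b'_n(y)\,b_{k-m-n+2}(y)\qquad(k\ge 7),$$ $$R_k=\sum_{m=3}^{k-4}\sum_{n=3}^{k-m-1}\frac{b_m(y)\,b_n(y)\,b''_{k-m-n+2}(y)}{k-m-n+2}\qquad(k\ge 7),$$ and $Q_k=R_k=0$ for $4\le k\le 6$. The right-hand sides involve only $b_j$ with $3\le j\le k-1$, so each $b_k$ is uniquely determined. *)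

theory Defs
  imports "HOL-Analysis.Analysis"
begin

section \<open>The recursion for the coefficient functions\<close>

text \<open>
  The index ranges of \<open>Q\<close> and \<open>R\<close> are empty for \<open>k \<le> 6\<close>, so both vanish there.
  Subtraction on \<open>nat\<close> occurs only in indices, where it never truncates
  inside the (nonempty) summation ranges; the coefficients are computed in \<open>real\<close>.
\<close>

definition P_term :: "(nat \<Rightarrow> real \<Rightarrow> real) \<Rightarrow> nat \<Rightarrow> real \<Rightarrow> real" where
  "P_term b k y =
     (\<Sum>m = 3..k-1. 2 * (real k - 2 * real m + 3) / (real k - real m + 2)
        * b m y * deriv (b (k - m + 2)) y)"

definition Q_term :: "(nat \<Rightarrow> real \<Rightarrow> real) \<Rightarrow> nat \<Rightarrow> real \<Rightarrow> real" where
  "Q_term b k y =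
     (\<Sum>m = 3..k-4. \<Sum>n = 3..k-m-1. (3 * real n - real k + real m - 1) / (real m * real n)
        * deriv (b m) y * deriv (b n) y * b (k - m - n + 2) y)"

definition R_term :: "(nat \<Rightarrow> real \<Rightarrow> real) \<Rightarrow> nat \<Rightarrow> real \<Rightarrow> real" where
  "R_term b k y =
     (\<Sum>m = 3..k-4. \<Sum>n = 3..k-m-1.
        b m y * b n y * deriv (deriv (b (k - m - n + 2))) y / (real k - real m - real n + 2))"

definition zmc_recursion :: "real \<Rightarrow> (nat \<Rightarrow> real \<Rightarrow> real) \<Rightarrow> bool" where
  "zmc_recursion c b \<longleftrightarrow>
     b 0 = (\<lambda>y. y) \<and> b 1 = (\<lambda>y. 0) \<and> b 2 = (\<lambda>y. 0) \<and> b 3 = (\<lambda>y. 3 * c * y) \<and>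
     (\<forall>k\<ge>4.
        (\<forall>y. b k differentiable at y \<and> deriv (b k) differentiable at y \<and>
             deriv (deriv (b k)) y = - real k * (P_term b k y + Q_term b k y - R_term b k y)) \<and>
        b k 0 = 0 \<and> deriv (b k) 0 = 0)"

text \<open>
  Meaningful only together with unique solvability of the recursion,
  which is not built in here and has to be established separately.
\<close>

definition zmc_coeff :: "real \<Rightarrow> nat \<Rightarrow> real \<Rightarrow> real" where
  "zmc_coeff c = (THE b. zmc_recursion c b)"

text \<open>The tail \<open>\<Sum>k\<ge>4. b\<^sub>k(y)/k x\<^sup>k\<close>, with the index shifted to start at \<open>0\<close>.\<close>

definition zmc_tail :: "real \<Rightarrow> real \<Rightarrow> real \<Rightarrow> nat \<Rightarrow> real" where
  "zmc_tail c x y k = zmc_coeff c (k + 4) y / real (k + 4) * x ^ (k + 4)"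

definition zmc_series :: "real \<Rightarrow> real \<Rightarrow> real \<Rightarrow> real" where
  "zmc_series c x y = y + c * y * x ^ 3 + (\<Sum>k. zmc_tail c x y k)"


section \<open>Real analytic functions of two variables\<close>

text \<open>
  Local expandability into a double power series. The notion \<open>has_sum\<close> is unconditional
  (hence, over the reals, absolute) summation.
\<close>

definition real_analytic2_on :: "(real \<times> real) set \<Rightarrow> (real \<Rightarrow> real \<Rightarrow> real) \<Rightarrow> bool" where
  "real_analytic2_on U f \<longleftrightarrow>
     (\<forall>(x0, y0)\<in>U. \<exists>(a :: nat \<Rightarrow> nat \<Rightarrow> real) r. r > 0 \<and>
        (\<forall>x y. \<bar>x - x0\<bar> < r \<longrightarrow> \<bar>y - y0\<bar> < r \<longrightarrow>
           ((\<lambda>(i, j). a i j * (x - x0) ^ i * (y - y0) ^ j) has_sum f x y) UNIV))"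


section \<open>Graphs in Lorentz-Minkowski space\<close>

definition pdx :: "(real \<Rightarrow> real \<Rightarrow> real) \<Rightarrow> real \<Rightarrow> real \<Rightarrow> real" where
  "pdx f x y = deriv (\<lambda>s. f s y) x"

definition pdy :: "(real \<Rightarrow> real \<Rightarrow> real) \<Rightarrow> real \<Rightarrow> real \<Rightarrow> real" where
  "pdy f x y = deriv (\<lambda>s. f x s) y"

text \<open>
  Here \<open>pdy (pdx f)\<close> is \<open>f\<^sub>x\<^sub>y\<close>. Since \<open>deriv\<close> is total, the equation is imposed together
  with analyticity and openness of the domain.
\<close>

definition analytic_zmc_graph :: "(real \<times> real) set \<Rightarrow> (real \<Rightarrow> real \<Rightarrow> real) \<Rightarrow> bool" where
  "analytic_zmc_graph U f \<longleftrightarrow> open U \<and> real_analytic2_on U f \<and>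
     (\<forall>(x, y)\<in>U.
        (1 - (pdy f x y)\<^sup>2) * pdx (pdx f) x y
        + 2 * pdx f x y * pdy f x y * pdy (pdx f) x y
        + (1 - (pdx f x y)\<^sup>2) * pdy (pdy f) x y = 0)"

definition spacelike_at :: "(real \<Rightarrow> real \<Rightarrow> real) \<Rightarrow> real \<Rightarrow> real \<Rightarrow> bool" where
  "spacelike_at f x y \<longleftrightarrow> 1 - (pdx f x y)\<^sup>2 - (pdy f x y)\<^sup>2 > 0"

definition timelike_at :: "(real \<Rightarrow> real \<Rightarrow> real) \<Rightarrow> real \<Rightarrow> real \<Rightarrow> bool" where
  "timelike_at f x y \<longleftrightarrow> 1 - (pdx f x y)\<^sup>2 - (pdy f x y)\<^sup>2 < 0"

text \<open>Points of the ambient space are triples \<open>(t, x, y)\<close>, so \<open>snd\<close> projects to the \<open>(x, y)\<close>-plane.\<close>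

definition graph_over :: "(real \<times> real) set \<Rightarrow> (real \<Rightarrow> real \<Rightarrow> real) \<Rightarrow> (real \<times> real \<times> real) set" where
  "graph_over U f = {(f x y, x, y) | x y. (x, y) \<in> U}"

definition lorentz :: "real \<times> real \<times> real \<Rightarrow> real \<times> real \<times> real \<Rightarrow> real" where
  "lorentz = (\<lambda>(t, x, y) (t', x', y'). - t * t' + x * x' + y * y')"

definition null_vector :: "real \<times> real \<times> real \<Rightarrow> bool" where
  "null_vector v \<longleftrightarrow> v \<noteq> 0 \<and> lorentz v v = 0"

definition det2 :: "real \<times> real \<Rightarrow> real \<times> real \<Rightarrow> real" where
  "det2 = (\<lambda>(a, b) (a', b'). a * b' - b * a')"

text \<open>
  The graph of \<open>f\<close> over \<open>U\<close> changes type across the light-like line \<open>L\<close> near the point \<open>q\<close> of \<open>L\<close>.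
  The spatial part \<open>snd v\<close> of a null vector is nonzero, so \<open>L\<close> projects to a line in the
  \<open>(x, y)\<close>-plane, whose two sides are told apart by the sign of the determinant. Either side may be
  the space-like one, because \<open>v\<close> may be replaced by \<open>- v\<close>.
\<close>

definition changes_type_across ::
    "(real \<times> real \<times> real) set \<Rightarrow> real \<times> real \<times> real \<Rightarrow> (real \<times> real) set \<Rightarrow> (real \<Rightarrow> real \<Rightarrow> real) \<Rightarrow> bool" where
  "changes_type_across L q U f \<longleftrightarrow>
     (\<exists>v. null_vector v \<and> L = {q + s *\<^sub>R v | s. True} \<and>
        (\<exists>\<epsilon>>0. \<exists>V. open V \<and> V \<subseteq> U \<and>
           (\<forall>s. \<bar>s\<bar> < \<epsilon> \<longrightarrow> q + s *\<^sub>R v \<in> graph_over V f) \<and>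
           (\<forall>(x, y)\<in>V.
              (det2 (snd v) ((x, y) - snd q) > 0 \<longrightarrow> spacelike_at f x y) \<and>
              (det2 (snd v) ((x, y) - snd q) < 0 \<longrightarrow> timelike_at f x y))))"

end

theory Submission
  imports Defs
begin

text \<open>
  Write \<open>f = y + g\<close>. Solved for \<open>g\<^sub>y\<^sub>y\<close>, the zero mean curvature equation reads
  \<open>g\<^sub>y\<^sub>y = 2 g\<^sub>y g\<^sub>x\<^sub>x - 2 g\<^sub>x g\<^sub>x\<^sub>y + g\<^sub>y\<^sup>2 g\<^sub>x\<^sub>x - 2 g\<^sub>x g\<^sub>y g\<^sub>x\<^sub>y + g\<^sub>x\<^sup>2 g\<^sub>y\<^sub>y\<close>,
  and the recursion for the \<open>b\<^sub>k\<close> is the comparison of the coefficients of \<open>x\<^sup>k\<close> in this equation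
  (\<open>zmc_fps_pde\<close>). The conditions at \<open>y = 0\<close> say that \<open>g(x, 0) = 0\<close> and \<open>g\<^sub>y(x, 0) = c x\<^sup>3\<close>. So \<open>g\<close>
  is the formal solution of a Cauchy problem with data on the line \<open>y = 0\<close>, which is not
  characteristic, and convergence is an instance of the Cauchy-Kovalevskaya theorem.

  The proof of convergence looks for a majorant of the form \<open>\<phi>(x + y)\<close>. All partial derivatives
  of such a function of a given order coincide, so the right-hand side of the equation is majorized
  by \<open>4 \<phi>' \<phi>'' + 4 \<phi>'\<^sup>2 \<phi>''\<close>, and the argument closes if this is at most \<open>\<phi>''\<close>
  (\<open>majorized_of_pde\<close>). The expression is the derivative of \<open>2 \<phi>'\<^sup>2 + 4/3 \<phi>'\<^sup>3\<close>; it suffices that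
  \<open>\<phi>'\<^sup>2 \<le> \<phi>' / 3\<close> coefficientwise (\<open>slope_majorant_ineq\<close>). A series with coefficients
  \<open>R\<^sup>n / (24 (n + 1)\<^sup>2)\<close> has this property for every \<open>R \<ge> 0\<close>, and a large \<open>R\<close> makes it dominate
  \<open>c x\<^sup>3\<close>. Hence all coefficients of \<open>g\<close> grow at most geometrically in the total degree
  (\<open>zmc_fps_geometric_bound\<close>).

  On a square around the origin the formal identity may then be evaluated, and re-expansion at
  other points of the square gives real analyticity. Furthermore
  \<open>1 - f\<^sub>x\<^sup>2 - f\<^sub>y\<^sup>2 = - 2 c x\<^sup>3 + O(x\<^sup>4)\<close> uniformly in \<open>y\<close> (\<open>type_function_asymptotics\<close>), so for
  \<open>c > 0\<close> the graph is space-like for small \<open>x < 0\<close> and time-like for small \<open>x > 0\<close>. Finally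
  \<open>f\<^sub>y(x, 0) = 1 + c x\<^sup>3\<close> shows that the germ of \<open>f\<close> at the origin determines \<open>c\<close>.
\<close>

section \<open>Polynomial solution of the recursion\<close>

definition antideriv2 :: "real poly \<Rightarrow> real poly" where
  "antideriv2 q = (\<Sum>i\<le>degree q. monom (coeff q i / (real (i + 1) * real (i + 2))) (i + 2))"

lemma coeff_antideriv2:
  "coeff (antideriv2 q) j = (if j < 2 then 0 else coeff q (j - 2) / (real (j - 1) * real j))"
proof -
  have "coeff (antideriv2 q) j =
      (\<Sum>i\<le>degree q. if i + 2 = j then coeff q i / (real (i + 1) * real (i + 2)) else 0)"
    unfolding antideriv2_def coeff_sum coeff_monom ..
  also have "\<dots> = (if j < 2 then 0 else coeff q (j - 2) / (real (j - 1) * real j))"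
  proof (cases "j < 2")
    case False
    then obtain i where j: "j = i + 2" by (metis add.commute le_Suc_ex not_le)
    show ?thesis by (simp add: j sum.delta coeff_eq_0 not_le)
  qed (auto intro!: sum.neutral)
  finally show ?thesis .
qed

lemma pderiv_pderiv_antideriv2 [simp]: "pderiv (pderiv (antideriv2 q)) = q"
proof (rule poly_eqI)
  fix n
  have "(1 + real n) * (2 + real n) \<noteq> 0"
    by (metis add_pos_nonneg less_numeral_extra(3) mult_eq_0_iff of_nat_0_le_iff zero_less_numeral zero_less_one)
  then show "coeff (pderiv (pderiv (antideriv2 q))) n = coeff q n"
    by (simp add: coeff_pderiv coeff_antideriv2 mult.assoc)
qed

lemma poly_antideriv2_0 [simp]:
  "poly (antideriv2 q) 0 = 0" "poly (pderiv (antideriv2 q)) 0 = 0"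
  by (simp_all add: poly_0_coeff_0 coeff_pderiv coeff_antideriv2)

text \<open>
  Every \<open>b\<^sub>k\<close> is a polynomial in \<open>y\<close>. The three sums are therefore repeated on polynomials, so that
  they can be recognised as coefficients of products of formal power series in \<open>x\<close>.
\<close>

definition P_poly :: "(nat \<Rightarrow> real poly) \<Rightarrow> nat \<Rightarrow> real poly" where
  "P_poly p k =
     (\<Sum>m = 3..k-1. smult (2 * (real k - 2 * real m + 3) / (real k - real m + 2))
        (p m * pderiv (p (k - m + 2))))"

definition Q_poly :: "(nat \<Rightarrow> real poly) \<Rightarrow> nat \<Rightarrow> real poly" where
  "Q_poly p k =
     (\<Sum>m = 3..k-4. \<Sum>n = 3..k-m-1. smult ((3 * real n - real k + real m - 1) / (real m * real n))
        (pderiv (p m) * pderiv (p n) * p (k - m - n + 2)))"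

definition R_poly :: "(nat \<Rightarrow> real poly) \<Rightarrow> nat \<Rightarrow> real poly" where
  "R_poly p k =
     (\<Sum>m = 3..k-4. \<Sum>n = 3..k-m-1. smult (1 / (real k - real m - real n + 2))
        (p m * p n * pderiv (pderiv (p (k - m - n + 2)))))"

definition rec_rhs :: "(nat \<Rightarrow> real poly) \<Rightarrow> nat \<Rightarrow> real poly" where
  "rec_rhs p k = smult (- real k) (P_poly p k + Q_poly p k - R_poly p k)"

text \<open>
  The right-hand side at index \<open>k\<close> refers to smaller indices only: \<open>m, n \<ge> 3\<close> forces
  \<open>k - m + 2 < k\<close>. As a congruence rule for recursive definitions, this fact makes the recursion
  below terminate.
\<close>

lemma rec_rhs_cong [fundef_cong]:
  assumes "k = k'" "\<And>j. j < k' \<Longrightarrow> p j = q j"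
  shows "rec_rhs p k = rec_rhs q k'"
proof -
  have "P_poly p k = P_poly q k" unfolding P_poly_def
    by (intro sum.cong refl) (use assms in auto)
  moreover have "Q_poly p k = Q_poly q k" unfolding Q_poly_def
    by (intro sum.cong refl) (use assms in auto)
  moreover have "R_poly p k = R_poly q k" unfolding R_poly_def
    by (intro sum.cong refl) (use assms in auto)
  ultimately show ?thesis using assms by (simp add: rec_rhs_def)
qed

fun zmc_poly :: "real \<Rightarrow> nat \<Rightarrow> real poly" where
  "zmc_poly c k =
     (if k = 0 then [:0, 1:] else if k < 3 then 0 else if k = 3 then [:0, 3 * c:]
      else antideriv2 (rec_rhs (zmc_poly c) k))"

declare zmc_poly.simps [simp del]

lemma zmc_poly_base:
  "zmc_poly c 0 = [:0, 1:]" "zmc_poly c 1 = 0" "zmc_poly c 2 = 0" "zmc_poly c 3 = [:0, 3 * c:]"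
  by (simp_all add: zmc_poly.simps)

lemma zmc_poly_step: "k \<ge> 4 \<Longrightarrow> zmc_poly c k = antideriv2 (rec_rhs (zmc_poly c) k)"
  by (subst zmc_poly.simps) simp

lemma coeff_zmc_poly:
  "coeff (zmc_poly c k) 0 = 0"
  "coeff (zmc_poly c k) 1 = (if k = 0 then 1 else if k = 3 then 3 * c else 0)"
proof -
  consider "k = 0" | "k = 1" | "k = 2" | "k = 3" | "4 \<le> k" by linarith
  then have "coeff (zmc_poly c k) 0 = 0 \<and>
      coeff (zmc_poly c k) 1 = (if k = 0 then 1 else if k = 3 then 3 * c else 0)"
    by cases (auto simp: zmc_poly_base[unfolded One_nat_def] zmc_poly_step coeff_antideriv2)
  then show "coeff (zmc_poly c k) 0 = 0"
    "coeff (zmc_poly c k) 1 = (if k = 0 then 1 else if k = 3 then 3 * c else 0)" by auto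
qed

lemma deriv_poly: "deriv (poly p) = poly (pderiv p)" for p :: "real poly"
  by (rule ext) (simp add: DERIV_imp_deriv poly_DERIV)

lemma P_term_eq_poly:
  assumes "\<And>j. j < k \<Longrightarrow> b j = poly (p j)"
  shows "P_term b k y = poly (P_poly p k) y"
  unfolding P_term_def P_poly_def poly_sum
  by (intro sum.cong refl) (use assms in \<open>auto simp: deriv_poly\<close>)

lemma Q_term_eq_poly:
  assumes "\<And>j. j < k \<Longrightarrow> b j = poly (p j)"
  shows "Q_term b k y = poly (Q_poly p k) y"
  unfolding Q_term_def Q_poly_def poly_sum
  by (intro sum.cong refl) (use assms in \<open>auto simp: deriv_poly\<close>)

lemma R_term_eq_poly:
  assumes "\<And>j. j < k \<Longrightarrow> b j = poly (p j)"
  shows "R_term b k y = poly (R_poly p k) y"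
  unfolding R_term_def R_poly_def poly_sum
  by (intro sum.cong refl) (use assms in \<open>auto simp: deriv_poly\<close>)

lemma zmc_recursion_zmc_poly: "zmc_recursion c (\<lambda>k. poly (zmc_poly c k))"
  unfolding zmc_recursion_def
proof (intro conjI allI impI)
  fix k :: nat and y :: real
  assume k: "4 \<le> k"
  show "poly (zmc_poly c k) differentiable at y" "deriv (poly (zmc_poly c k)) differentiable at y"
    unfolding deriv_poly by (auto simp: differentiable_def intro!: poly_DERIV has_field_derivative_imp_has_derivative)
  show "deriv (deriv (poly (zmc_poly c k))) y = - real k *
      (P_term (\<lambda>k. poly (zmc_poly c k)) k y + Q_term (\<lambda>k. poly (zmc_poly c k)) k y
        - R_term (\<lambda>k. poly (zmc_poly c k)) k y)"
    unfolding deriv_poly zmc_poly_step[OF k] pderiv_pderiv_antideriv2 rec_rhs_def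
    by (simp add: P_term_eq_poly[where p = "zmc_poly c"] Q_term_eq_poly[where p = "zmc_poly c"]
        R_term_eq_poly[where p = "zmc_poly c"])
qed (auto simp: deriv_poly zmc_poly_step zmc_poly_base[unfolded One_nat_def] fun_eq_iff)

lemma zero_if_deriv2_zero:
  fixes h :: "real \<Rightarrow> real"
  assumes "\<And>y. h differentiable at y" "\<And>y. deriv h differentiable at y"
    and "\<And>y. deriv (deriv h) y = 0" "h 0 = 0" "deriv h 0 = 0"
  shows "h y = 0"
proof -
  have "(deriv h has_real_derivative 0) (at z)" for z
    using assms(2)[of z] assms(3)[of z] by (metis DERIV_deriv_iff_real_differentiable)
  then have "deriv h z = 0" for z
    using DERIV_isconst_all[of "deriv h" z 0] assms(5) by auto
  then have "(h has_real_derivative 0) (at z)" for z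
    using assms(1)[of z] by (metis DERIV_deriv_iff_real_differentiable)
  then show ?thesis
    using DERIV_isconst_all[of h y 0] assms(4) by auto
qed

text \<open>
  By strong induction. Once all earlier functions are known, \<open>b\<^sub>k\<close> and the polynomial have the same
  second derivative and the same value and slope at \<open>0\<close>.
\<close>

lemma zmc_recursion_unique:
  assumes b: "zmc_recursion c b"
  shows "b = (\<lambda>k. poly (zmc_poly c k))"
proof
  fix k
  show "b k = poly (zmc_poly c k)"
  proof (induction k rule: less_induct)
    case (less k)
    consider "k = 0" | "k = 1" | "k = 2" | "k = 3" | "4 \<le> k" by linarith
    then show ?case
    proof cases
      case 5
      let ?p = "poly (zmc_poly c k)"
      have b1: "b k differentiable at y" "deriv (b k) differentiable at y"
        "deriv (deriv (b k)) y = - real k * (P_term b k y + Q_term b k y - R_term b k y)"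
        "b k 0 = 0" "deriv (b k) 0 = 0" for y
        using b 5 by (auto simp: zmc_recursion_def)
      have p1: "?p differentiable at y" "poly (pderiv (zmc_poly c k)) differentiable at y" for y
        by (auto simp: differentiable_def intro!: poly_DERIV has_field_derivative_imp_has_derivative)
      have dd: "deriv (deriv (b k)) y = poly (pderiv (pderiv (zmc_poly c k))) y" for y
        unfolding b1(3) zmc_poly_step[OF 5] pderiv_pderiv_antideriv2 rec_rhs_def
        using less by (simp add: P_term_eq_poly[where p = "zmc_poly c"]
            Q_term_eq_poly[where p = "zmc_poly c"] R_term_eq_poly[where p = "zmc_poly c"])
      define h where "h = (\<lambda>y. b k y - ?p y)"
      have dh: "deriv h = (\<lambda>y. deriv (b k) y - poly (pderiv (zmc_poly c k)) y)"
        unfolding h_def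
        by (rule ext, rule DERIV_imp_deriv, intro DERIV_diff poly_DERIV)
          (use b1(1) in \<open>simp add: DERIV_deriv_iff_real_differentiable\<close>)
      have ddh: "deriv (deriv h) y = 0" for y
      proof -
        have "(deriv h has_real_derivative
            deriv (deriv (b k)) y - poly (pderiv (pderiv (zmc_poly c k))) y) (at y)"
          unfolding dh by (intro DERIV_diff poly_DERIV)
            (use b1(2) in \<open>simp add: DERIV_deriv_iff_real_differentiable\<close>)
        then show ?thesis by (simp add: DERIV_imp_deriv dd)
      qed
      have "h y = 0" for y
      proof (rule zero_if_deriv2_zero[of h])
        show "h differentiable at y" "deriv h differentiable at y" for y
          unfolding dh unfolding h_def using b1 p1 by (intro differentiable_diff; simp)+
        show "h 0 = 0" "deriv h 0 = 0"
          unfolding dh unfolding h_def using b1 5 by (auto simp: zmc_poly_step)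
      qed (rule ddh)
      then show ?thesis by (auto simp: h_def fun_eq_iff)
    qed (use b in \<open>auto simp: zmc_recursion_def zmc_poly_base[unfolded One_nat_def] fun_eq_iff\<close>)
  qed
qed

lemma zmc_coeff_eq: "zmc_coeff c k = poly (zmc_poly c k)"
proof -
  have "zmc_coeff c = (\<lambda>k. poly (zmc_poly c k))"
    unfolding zmc_coeff_def
    using zmc_recursion_zmc_poly zmc_recursion_unique by (rule the_equality)
  then show ?thesis by simp
qed

section \<open>The recursion as a differential equation for a formal series\<close>

text \<open>
  A series in two variables is a power series in the outer variable \<open>x\<close> whose coefficients are
  polynomials in \<open>y\<close>. Then \<^const>\<open>fps_deriv\<close> is the partial derivative in \<open>x\<close>, and the one
  in \<open>y\<close> acts on the coefficients.
\<close>

definition fps_dy :: "real poly fps \<Rightarrow> real poly fps" where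
  "fps_dy A = Abs_fps (\<lambda>k. pderiv (fps_nth A k))"

lemma fps_dy_nth [simp]: "fps_nth (fps_dy A) k = pderiv (fps_nth A k)"
  by (simp add: fps_dy_def)

text \<open>
  The index ranges of the sums \<open>P\<close>, \<open>Q\<close>, \<open>R\<close> come from the fact that all factors are of order at
  least three in \<open>x\<close>. The offset \<open>2\<close> is the number of derivatives in \<open>x\<close> that each product of the
  differential equation contains.
\<close>

lemma fps_mult_nth_order3:
  fixes A B :: "'a :: comm_ring_1 fps"
  assumes "\<And>i. i < 3 \<Longrightarrow> fps_nth A i = 0" "\<And>i. i < 3 \<Longrightarrow> fps_nth B i = 0"
  shows "fps_nth (A * B) (k + 2) = (\<Sum>m = 3..k-1. fps_nth A m * fps_nth B (k - m + 2))"
proof -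
  have "fps_nth (A * B) (k + 2) = (\<Sum>m = 0..k+2. fps_nth A m * fps_nth B (k + 2 - m))"
    by (simp add: fps_mult_nth)
  also have "\<dots> = (\<Sum>m = 3..k-1. fps_nth A m * fps_nth B (k + 2 - m))"
  proof (rule sum.mono_neutral_right)
    show "\<forall>m\<in>{0..k + 2} - {3..k - 1}. fps_nth A m * fps_nth B (k + 2 - m) = 0"
    proof
      fix m assume "m \<in> {0..k + 2} - {3..k - 1}"
      then have "m < 3 \<or> k + 2 - m < 3" by auto
      then show "fps_nth A m * fps_nth B (k + 2 - m) = 0" using assms by auto
    qed
  qed auto
  also have "\<dots> = (\<Sum>m = 3..k-1. fps_nth A m * fps_nth B (k - m + 2))"
    by (intro sum.cong refl) (auto simp: Suc_diff_le)
  finally show ?thesis .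
qed

lemma fps_mult3_nth_order3:
  fixes A B C :: "'a :: comm_ring_1 fps"
  assumes A: "\<And>i. i < 3 \<Longrightarrow> fps_nth A i = 0" and B: "\<And>i. i < 3 \<Longrightarrow> fps_nth B i = 0"
    and C: "\<And>i. i < 3 \<Longrightarrow> fps_nth C i = 0"
  shows "fps_nth (A * (B * C)) (k + 2) =
    (\<Sum>m = 3..k-4. \<Sum>n = 3..k-m-1. fps_nth A m * (fps_nth B n * fps_nth C (k - m - n + 2)))"
proof -
  have BC: "fps_nth (B * C) i = 0" if "i < 6" for i
    unfolding fps_mult_nth
  proof (rule sum.neutral, rule ballI)
    fix j assume "j \<in> {0..i}"
    then have "j < 3 \<or> i - j < 3" using that by auto
    then show "fps_nth B j * fps_nth C (i - j) = 0" using B C by auto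
  qed
  have "fps_nth (A * (B * C)) (k + 2) = (\<Sum>m = 3..k-1. fps_nth A m * fps_nth (B * C) (k - m + 2))"
    by (rule fps_mult_nth_order3) (use A BC in auto)
  also have "\<dots> = (\<Sum>m = 3..k-4. fps_nth A m * fps_nth (B * C) (k - m + 2))"
    by (rule sum.mono_neutral_right) (use BC in auto)
  also have "\<dots> = (\<Sum>m = 3..k-4. \<Sum>n = 3..k-m-1.
      fps_nth A m * (fps_nth B n * fps_nth C (k - m - n + 2)))"
    by (simp only: fps_mult_nth_order3[of B C, OF B C] sum_distrib_left)
  finally show ?thesis .
qed

text \<open>
  The formal series of \<open>g = f - y\<close>. The term \<open>b\<^sub>0 = y\<close> drops out, because \<open>1 / 0 = 0\<close>.
\<close>

definition zmc_fps :: "real \<Rightarrow> real poly fps" where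
  "zmc_fps c = Abs_fps (\<lambda>k. smult (1 / real k) (zmc_poly c k))"

lemma zmc_fps_nth [simp]: "fps_nth (zmc_fps c) k = smult (1 / real k) (zmc_poly c k)"
  by (simp add: zmc_fps_def)

text \<open>
  The relation also holds below \<open>k = 4\<close>: there all sums are empty and all \<open>b\<^sub>k\<close> are linear.
\<close>

lemma zmc_poly_pderiv2: "pderiv (pderiv (zmc_poly c k)) = rec_rhs (zmc_poly c) k"
proof (cases "k \<ge> 4")
  case True
  then show ?thesis by (simp add: zmc_poly_step)
next
  case False
  then consider "k = 0" | "k = 1" | "k = 2" | "k = 3" by linarith
  then show ?thesis
    by cases (auto simp: zmc_poly_base[unfolded One_nat_def] rec_rhs_def P_poly_def Q_poly_def
        R_poly_def pderiv_pCons)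
qed

text \<open>
  The zero mean curvature equation for \<open>f = y + g\<close>, solved for the second derivative of \<open>g\<close> in
  \<open>y\<close>. Multiplication by \<open>x\<^sup>2\<close> replaces the derivatives in \<open>x\<close> by the operators \<open>x \<partial>\<^sub>x\<close> and
  \<open>x\<^sup>2 \<partial>\<^sub>x\<^sup>2\<close>, which multiply the coefficient of \<open>x\<^sup>m\<close> by \<open>m\<close> and \<open>m (m - 1)\<close>. No indices
  are shifted, and the coefficient of \<open>x\<close> to the power \<open>k + 2\<close> is literally the recursion at \<open>k\<close>.
\<close>

lemma zmc_fps_pde:
  fixes c :: real
  defines "G \<equiv> zmc_fps c"
  defines "Gx \<equiv> fps_deriv G" and "Gy \<equiv> fps_dy G"
  defines "Gxx \<equiv> fps_deriv Gx" and "Gxy \<equiv> fps_dy Gx" and "Gyy \<equiv> fps_dy Gy"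
  shows "Gyy = 2 * (Gy * Gxx) - 2 * (Gx * Gxy) + Gy * (Gy * Gxx) - 2 * (Gy * (Gxy * Gx))
    + Gx * (Gx * Gyy)"
proof (rule fps_ext)
  fix k
  \<comment> \<open>\<open>q\<close> differs from \<open>b\<close> only at index \<open>0\<close>; it makes the factors start at order three.\<close>
  define q where "q m = (if m < 3 then 0 else zmc_poly c m)" for m
  have q0: "q m = 0" if "m < 3" for m using that by (simp add: q_def)
  have sq: "smult (1 / real m) (zmc_poly c m) = smult (1 / real m) (q m)" for m
  proof -
    consider "m = 0" | "m = 1" | "m = 2" | "\<not> m < 3" by linarith
    then show ?thesis by cases (simp_all add: q_def zmc_poly_base[unfolded One_nat_def])
  qed
  define T where "T = fps_X * Gx"
  define Ty where "Ty = fps_X * Gxy"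
  define W where "W = fps_X\<^sup>2 * Gxx"
  have nat_mult: "of_nat n * p = smult (real n) p" for n and p :: "real poly"
    by (simp add: of_nat_poly)
  have T: "fps_nth T m = q m" for m
    unfolding T_def Gx_def G_def
    by (cases m) (auto simp: sq nat_mult q0 simp del: of_nat_Suc)
  have Ty: "fps_nth Ty m = pderiv (q m)" for m
    unfolding Ty_def Gxy_def Gx_def G_def
    by (cases m) (auto simp: sq nat_mult q0 pderiv_smult simp del: of_nat_Suc)
  have W: "fps_nth W m = smult (real m - 1) (q m)" for m
  proof (cases "m < 2")
    case True
    then show ?thesis by (simp add: W_def fps_X_power_mult_nth q0)
  next
    case False
    then obtain n where m: "m = Suc (Suc n)" by (metis add_2_eq_Suc le_Suc_ex not_le)
    show ?thesis
      unfolding W_def Gxx_def Gx_def G_def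
      by (simp add: m fps_X_power_mult_nth sq nat_mult del: of_nat_Suc) simp
  qed
  have Gy: "fps_nth Gy m = smult (1 / real m) (pderiv (q m))" for m
    unfolding Gy_def G_def by (simp add: sq pderiv_smult)
  have Gyy: "fps_nth Gyy m = smult (1 / real m) (pderiv (pderiv (q m)))" for m
    unfolding Gyy_def Gy fps_dy_nth by (simp add: pderiv_smult)
  have two: "smult 2 p = p + p" for p :: "real poly"
    by (simp add: smult_add_left[of 1 1 p, simplified])

  \<comment> \<open>Each of the three sums of the recursion is a coefficient of products without index shifts.\<close>
  have P: "fps_nth (T * Ty) (k + 2) + fps_nth (T * Ty) (k + 2)
      - (fps_nth (W * Gy) (k + 2) + fps_nth (W * Gy) (k + 2)) = P_poly (zmc_poly c) k"
  proof -
    have "fps_nth (T * Ty) (k + 2) + fps_nth (T * Ty) (k + 2)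
      - (fps_nth (W * Gy) (k + 2) + fps_nth (W * Gy) (k + 2)) =
      (\<Sum>m = 3..k-1. smult 2 (q m * pderiv (q (k - m + 2)))
        - smult 2 (smult (real m - 1) (q m) * smult (1 / real (k - m + 2)) (pderiv (q (k - m + 2)))))"
      unfolding two sum_subtractf sum.distrib
      by (subst (1 2 3 4) fps_mult_nth_order3) (auto simp: T Ty W Gy q0)
    also have "\<dots> = P_poly (zmc_poly c) k"
      unfolding P_poly_def
    proof (rule sum.cong[OF refl])
      fix m assume m: "m \<in> {3..k - 1}"
      then have r: "real (k - m + 2) = real k - real m + 2" and n: "\<not> m < 3" "\<not> k - m + 2 < 3"
        by (auto simp: of_nat_diff)
      have nz: "real k - real m + 2 \<noteq> 0" using m by auto
      have "smult 2 (q m * pderiv (q (k - m + 2)))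
        - smult 2 (smult (real m - 1) (q m) * smult (1 / real (k - m + 2)) (pderiv (q (k - m + 2))))
        = smult (2 - 2 * (real m - 1) / (real k - real m + 2)) (q m * pderiv (q (k - m + 2)))"
        unfolding r smult_diff_left[of 2] mult_smult_left mult_smult_right smult_smult
        by simp
      also have "2 - 2 * (real m - 1) / (real k - real m + 2)
        = 2 * (real k - 2 * real m + 3) / (real k - real m + 2)"
        using nz by (simp add: field_simps)
      finally show "smult 2 (q m * pderiv (q (k - m + 2)))
        - smult 2 (smult (real m - 1) (q m) * smult (1 / real (k - m + 2)) (pderiv (q (k - m + 2))))
        = smult (2 * (real k - 2 * real m + 3) / (real k - real m + 2))
        (zmc_poly c m * pderiv (zmc_poly c (k - m + 2)))"
        using n by (simp add: q_def)
    qed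
    finally show ?thesis .
  qed
  have Q: "fps_nth (Gy * (Ty * T)) (k + 2) + fps_nth (Gy * (Ty * T)) (k + 2)
      - fps_nth (Gy * (Gy * W)) (k + 2) = Q_poly (zmc_poly c) k"
  proof -
    have "fps_nth (Gy * (Ty * T)) (k + 2) + fps_nth (Gy * (Ty * T)) (k + 2)
      - fps_nth (Gy * (Gy * W)) (k + 2) =
      (\<Sum>m = 3..k-4. \<Sum>n = 3..k-m-1. smult 2 (smult (1 / real m) (pderiv (q m)) *
          (pderiv (q n) * q (k - m - n + 2)))
        - smult (1 / real m) (pderiv (q m)) * (smult (1 / real n) (pderiv (q n))
          * smult (real (k - m - n + 2) - 1) (q (k - m - n + 2))))"
      unfolding two sum_subtractf sum.distrib
      by (subst (1 2 3) fps_mult3_nth_order3) (auto simp: T Ty W Gy q0)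
    also have "\<dots> = Q_poly (zmc_poly c) k"
      unfolding Q_poly_def
    proof (intro sum.cong refl)
      fix m n assume m: "m \<in> {3..k - 4}" and n: "n \<in> {3..k - m - 1}"
      then have r: "real (k - m - n + 2) = real k - real m - real n + 2"
        and l: "\<not> m < 3" "\<not> n < 3" "\<not> k - m - n + 2 < 3"
        by (auto simp: of_nat_diff)
      have nz: "real m \<noteq> 0" "real n \<noteq> 0" using m n by auto
      let ?X = "pderiv (q m) * pderiv (q n) * q (k - m - n + 2)"
      have "smult 2 (smult (1 / real m) (pderiv (q m)) * (pderiv (q n) * q (k - m - n + 2)))
        - smult (1 / real m) (pderiv (q m)) * (smult (1 / real n) (pderiv (q n))
          * smult (real (k - m - n + 2) - 1) (q (k - m - n + 2)))
        = smult (2 * (1 / real m) - 1 / real m * (1 / real n * (real k - real m - real n + 2 - 1))) ?X"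
        unfolding r smult_diff_left[of "2 * (1 / real m)"] mult_smult_left mult_smult_right smult_smult
        by (simp only: mult_ac)
      also have "2 * (1 / real m) - 1 / real m * (1 / real n * (real k - real m - real n + 2 - 1))
        = (3 * real n - real k + real m - 1) / (real m * real n)"
        using nz by (simp add: field_simps)
      finally show "smult 2 (smult (1 / real m) (pderiv (q m)) * (pderiv (q n) * q (k - m - n + 2)))
        - smult (1 / real m) (pderiv (q m)) * (smult (1 / real n) (pderiv (q n))
          * smult (real (k - m - n + 2) - 1) (q (k - m - n + 2)))
        = smult ((3 * real n - real k + real m - 1) / (real m * real n))
        (pderiv (zmc_poly c m) * pderiv (zmc_poly c n) * zmc_poly c (k - m - n + 2))"
        using l by (simp add: q_def)
    qed
    finally show ?thesis .
  qed
  have R: "fps_nth (T * (T * Gyy)) (k + 2) = R_poly (zmc_poly c) k"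
  proof -
    have "fps_nth (T * (T * Gyy)) (k + 2) = (\<Sum>m = 3..k-4. \<Sum>n = 3..k-m-1.
        q m * (q n * smult (1 / real (k - m - n + 2)) (pderiv (pderiv (q (k - m - n + 2))))))"
      by (subst fps_mult3_nth_order3) (auto simp: T Gyy q0)
    also have "\<dots> = R_poly (zmc_poly c) k"
      unfolding R_poly_def
    proof (intro sum.cong refl)
      fix m n assume m: "m \<in> {3..k - 4}" and n: "n \<in> {3..k - m - 1}"
      then have r: "real (k - m - n + 2) = real k - real m - real n + 2"
        and l: "\<not> m < 3" "\<not> n < 3" "\<not> k - m - n + 2 < 3"
        by (auto simp: of_nat_diff)
      show "q m * (q n * smult (1 / real (k - m - n + 2)) (pderiv (pderiv (q (k - m - n + 2)))))
        = smult (1 / (real k - real m - real n + 2))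
          (zmc_poly c m * zmc_poly c n * pderiv (pderiv (zmc_poly c (k - m - n + 2))))"
        unfolding r using l by (simp add: q_def mult_ac)
    qed
    finally show ?thesis .
  qed

  define H where "H = 2 * (Gy * Gxx) - 2 * (Gx * Gxy) + Gy * (Gy * Gxx) - 2 * (Gy * (Gxy * Gx))
    + Gx * (Gx * Gyy)"
  have XH: "fps_X\<^sup>2 * H = T * (T * Gyy) - (T * Ty + T * Ty - (W * Gy + W * Gy))
      - (Gy * (Ty * T) + Gy * (Ty * T) - Gy * (Gy * W))"
    unfolding H_def T_def Ty_def W_def by (simp add: algebra_simps power2_eq_square)
  have "fps_nth H k = fps_nth (fps_X\<^sup>2 * H) (k + 2)"
    by (simp add: fps_X_power_mult_nth)
  also have "\<dots> = R_poly (zmc_poly c) k - P_poly (zmc_poly c) k - Q_poly (zmc_poly c) k"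
    unfolding XH fps_sub_nth fps_add_nth P Q R ..
  also have "\<dots> = smult (1 / real k) (rec_rhs (zmc_poly c) k)"
    by (cases "k = 0") (simp_all add: rec_rhs_def P_poly_def Q_poly_def R_poly_def)
  also have "\<dots> = fps_nth Gyy k"
    unfolding Gyy_def Gy_def G_def by (simp add: pderiv_smult zmc_poly_pderiv2)
  finally show "fps_nth Gyy k = fps_nth H k" by simp
qed

section \<open>Majorants in the sum of the variables\<close>

text \<open>
  The coefficient of \<open>x\<^sup>k y\<^sup>j\<close> in \<open>\<phi>(x + y)\<close> is the bound in this definition. Only degrees below
  \<open>J\<close> in \<open>y\<close> are compared, because the solution is estimated by induction on that degree.
\<close>

definition majorized :: "nat \<Rightarrow> real poly fps \<Rightarrow> real fps \<Rightarrow> bool" where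
  "majorized J A \<phi> \<longleftrightarrow>
     (\<forall>k. \<forall>j<J. \<bar>coeff (fps_nth A k) j\<bar> \<le> real ((k + j) choose k) * fps_nth \<phi> (k + j))"

definition nonneg_fps :: "real fps \<Rightarrow> bool" where
  "nonneg_fps \<phi> \<longleftrightarrow> (\<forall>n. 0 \<le> fps_nth \<phi> n)"

lemma nonneg_fps_mult: "nonneg_fps \<phi> \<Longrightarrow> nonneg_fps \<psi> \<Longrightarrow> nonneg_fps (\<phi> * \<psi>)"
  by (auto simp: nonneg_fps_def fps_mult_nth intro!: sum_nonneg)

lemma nonneg_fps_deriv: "nonneg_fps \<phi> \<Longrightarrow> nonneg_fps (fps_deriv \<phi>)"
  by (auto simp: nonneg_fps_def)

lemma majorized_antimono: "majorized J A \<phi> \<Longrightarrow> J' \<le> J \<Longrightarrow> majorized J' A \<phi>"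
  by (auto simp: majorized_def)

lemma majorized_add: "majorized J A \<phi> \<Longrightarrow> majorized J B \<psi> \<Longrightarrow> majorized J (A + B) (\<phi> + \<psi>)"
  unfolding majorized_def
  by (auto simp: distrib_left intro!: order_trans[OF abs_triangle_ineq] add_mono)

lemma majorized_diff: "majorized J A \<phi> \<Longrightarrow> majorized J B \<psi> \<Longrightarrow> majorized J (A - B) (\<phi> + \<psi>)"
  unfolding majorized_def
  by (auto simp: distrib_left intro!: order_trans[OF abs_triangle_ineq4] add_mono)

lemma majorized_double: "majorized J A \<phi> \<Longrightarrow> majorized J (2 * A) (2 * \<phi>)"
  unfolding mult_2 by (intro majorized_add)

lemma majorized_fps_deriv: "majorized J A \<phi> \<Longrightarrow> majorized J (fps_deriv A) (fps_deriv \<phi>)"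
  unfolding majorized_def
proof (intro allI impI)
  fix k j
  assume A: "\<forall>k. \<forall>j<J. \<bar>coeff (fps_nth A k) j\<bar> \<le> real (k + j choose k) * fps_nth \<phi> (k + j)"
    and j: "j < J"
  have "\<bar>coeff (fps_nth (fps_deriv A) k) j\<bar> = real (Suc k) * \<bar>coeff (fps_nth A (Suc k)) j\<bar>"
    by (simp add: of_nat_poly abs_mult del: of_nat_Suc)
  also have "\<dots> \<le> real (Suc k) * (real (Suc k + j choose Suc k) * fps_nth \<phi> (Suc k + j))"
    using A j by (intro mult_left_mono) (simp_all del: binomial_Suc_Suc add_Suc)
  also have "\<dots> = real (Suc k * (Suc (k + j) choose Suc k)) * fps_nth \<phi> (Suc (k + j))"
    by (simp only: of_nat_mult add_Suc mult.assoc)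
  also have "\<dots> = real (k + j choose k) * fps_nth (fps_deriv \<phi>) (k + j)"
    unfolding Suc_times_binomial by (simp only: of_nat_mult fps_deriv_nth Suc_eq_plus1 mult_ac)
  finally show "\<bar>coeff (fps_nth (fps_deriv A) k) j\<bar>
      \<le> real (k + j choose k) * fps_nth (fps_deriv \<phi>) (k + j)" .
qed

lemma Suc_times_Suc_add_choose: "Suc j * (Suc (k + j) choose k) = Suc (k + j) * (k + j choose k)"
proof -
  have "Suc (k + j) choose k = Suc (j + k) choose Suc j"
    using binomial_symmetric[of k "Suc (k + j)"] by (simp add: add.commute)
  moreover have "k + j choose k = j + k choose j"
    using binomial_symmetric[of k "k + j"] by (simp add: add.commute)
  ultimately show ?thesis using Suc_times_binomial[of j "j + k"] by (simp add: add.commute)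
qed

text \<open>
  Differentiation in \<open>y\<close> turns \<open>\<phi>(x + y)\<close> into \<open>\<phi>'(x + y)\<close> and the degree bound \<open>J + 1\<close>
  into \<open>J\<close>. Together with a bound on the initial values this can be reversed, so estimates of
  a derivative can be integrated.
\<close>

lemma majorized_Suc_iff:
  "majorized (Suc J) A \<phi> \<longleftrightarrow>
    (\<forall>k. \<bar>coeff (fps_nth A k) 0\<bar> \<le> fps_nth \<phi> k) \<and> majorized J (fps_dy A) (fps_deriv \<phi>)"
proof -
  have "\<bar>coeff (fps_nth (fps_dy A) k) j\<bar> \<le> real (k + j choose k) * fps_nth (fps_deriv \<phi>) (k + j)
      \<longleftrightarrow> \<bar>coeff (fps_nth A k) (Suc j)\<bar> \<le> real (k + Suc j choose k) * fps_nth \<phi> (k + Suc j)"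
    (is "?l \<longleftrightarrow> ?r") for k j
  proof -
    have "real (k + j choose k) * fps_nth (fps_deriv \<phi>) (k + j)
        = real (Suc (k + j) * (k + j choose k)) * fps_nth \<phi> (Suc (k + j))"
      by (simp add: mult_ac del: mult_Suc mult_Suc_right of_nat_Suc)
    also have "\<dots> = real (Suc j) * (real (k + Suc j choose k) * fps_nth \<phi> (k + Suc j))"
      unfolding Suc_times_Suc_add_choose[symmetric] by (simp only: of_nat_mult add_Suc_right mult.assoc)
    finally have rhs: "real (k + j choose k) * fps_nth (fps_deriv \<phi>) (k + j)
        = real (Suc j) * (real (k + Suc j choose k) * fps_nth \<phi> (k + Suc j))" .
    have "\<bar>coeff (fps_nth (fps_dy A) k) j\<bar> = real (Suc j) * \<bar>coeff (fps_nth A k) (Suc j)\<bar>"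
      by (simp add: coeff_pderiv abs_mult)
    then have "?l \<longleftrightarrow> real (Suc j) * \<bar>coeff (fps_nth A k) (Suc j)\<bar>
        \<le> real (Suc j) * (real (k + Suc j choose k) * fps_nth \<phi> (k + Suc j))"
      unfolding rhs by (simp only:)
    then show ?thesis by (simp add: mult_le_cancel_left_pos del: of_nat_Suc)
  qed
  then show ?thesis
    unfolding majorized_def All_less_Suc2 by (auto simp del: fps_dy_nth fps_deriv_nth)
qed

text \<open>
  This is \<open>u(x + y) v(x + y) = (u v)(x + y)\<close>, compared at \<open>x\<^sup>k y\<^sup>j\<close>. For fixed \<open>s = i + l\<close> it is
  Vandermonde's identity; the terms with \<open>s < i\<close> or \<open>s > i + j\<close> that the interchange of the
  sums adds contain a vanishing binomial coefficient.
\<close>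

lemma binomial_convolution:
  fixes u v :: "nat \<Rightarrow> real"
  shows "(\<Sum>i\<le>k. \<Sum>l\<le>j. (real (i + l choose i) * u (i + l)) *
      (real (k - i + (j - l) choose (k - i)) * v (k - i + (j - l))))
    = real (k + j choose k) * (\<Sum>s\<le>k + j. u s * v (k + j - s))"
proof -
  define g where "g i s = real ((s choose i) * ((k + j - s) choose (k - i))) * (u s * v (k + j - s))" for i s
  have "(\<Sum>l\<le>j. (real (i + l choose i) * u (i + l)) *
      (real (k - i + (j - l) choose (k - i)) * v (k - i + (j - l)))) = (\<Sum>s\<le>k + j. g i s)"
    if i: "i \<le> k" for i
  proof -
    have "(\<Sum>l\<le>j. (real (i + l choose i) * u (i + l)) *
      (real (k - i + (j - l) choose (k - i)) * v (k - i + (j - l)))) = (\<Sum>l\<le>j. g i (i + l))"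
    proof (rule sum.cong[OF refl])
      fix l assume "l \<in> {..j}"
      then have "k - i + (j - l) = k + j - (i + l)" using i by auto
      then show "(real (i + l choose i) * u (i + l)) *
          (real (k - i + (j - l) choose (k - i)) * v (k - i + (j - l))) = g i (i + l)"
        by (simp add: g_def)
    qed
    also have "\<dots> = (\<Sum>s\<in>{i..i + j}. g i s)"
      by (rule sum.reindex_bij_witness[of _ "\<lambda>s. s - i" "\<lambda>l. i + l"]) auto
    also have "\<dots> = (\<Sum>s\<le>k + j. g i s)"
      by (rule sum.mono_neutral_left) (use i in \<open>auto simp: g_def binomial_eq_0 not_le\<close>)
    finally show ?thesis .
  qed
  then have "(\<Sum>i\<le>k. \<Sum>l\<le>j. (real (i + l choose i) * u (i + l)) *
      (real (k - i + (j - l) choose (k - i)) * v (k - i + (j - l)))) = (\<Sum>i\<le>k. \<Sum>s\<le>k + j. g i s)"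
    by simp
  also have "\<dots> = (\<Sum>s\<le>k + j. \<Sum>i\<le>k. g i s)"
    by (rule sum.swap)
  also have "\<dots> = (\<Sum>s\<le>k + j. real (k + j choose k) * (u s * v (k + j - s)))"
  proof (rule sum.cong[OF refl])
    fix s assume s: "s \<in> {..k + j}"
    have "(\<Sum>i\<le>k. g i s) = real (\<Sum>i\<le>k. (s choose i) * ((k + j - s) choose (k - i))) * (u s * v (k + j - s))"
      by (simp add: g_def sum_distrib_right)
    also have "(\<Sum>i\<le>k. (s choose i) * ((k + j - s) choose (k - i))) = (k + j choose k)"
      using s by (simp add: vandermonde)
    finally show "(\<Sum>i\<le>k. g i s) = real (k + j choose k) * (u s * v (k + j - s))" .
  qed
  finally show ?thesis by (simp add: sum_distrib_left)
qed

text \<open>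
  If \<open>A\<close> vanishes on \<open>y = 0\<close>, every coefficient of \<open>B\<close> that enters has lower degree in \<open>y\<close> than the
  resulting coefficient, so one degree less of \<open>B\<close> has to be controlled. This handles the term
  \<open>g\<^sub>x\<^sup>2 g\<^sub>y\<^sub>y\<close>, which contains the highest derivative.
\<close>

lemma majorized_mult:
  assumes A: "majorized J A \<phi>" and B: "majorized (J - 1) B \<psi>"
    and AB: "majorized J B \<psi> \<or> (\<forall>k. coeff (fps_nth A k) 0 = 0)"
    and nonneg: "nonneg_fps \<phi>" "nonneg_fps \<psi>"
  shows "majorized J (A * B) (\<phi> * \<psi>)"
  unfolding majorized_def
proof (intro allI impI)
  fix k j assume j: "j < J"
  have bound: "\<bar>coeff (fps_nth A i) l * coeff (fps_nth B (k - i)) (j - l)\<bar>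
      \<le> (real (i + l choose i) * fps_nth \<phi> (i + l)) *
        (real (k - i + (j - l) choose (k - i)) * fps_nth \<psi> (k - i + (j - l)))"
    (is "?lhs i l \<le> ?rhs i l") if "l \<le> j" for i l
  proof (cases "l = 0 \<and> \<not> majorized J B \<psi>")
    case True
    then have "?lhs i l = 0" using AB by auto
    also have "0 \<le> ?rhs i l" using nonneg by (auto simp: nonneg_fps_def intro!: mult_nonneg_nonneg)
    finally show ?thesis .
  next
    case False
    then have "\<bar>coeff (fps_nth B (k - i)) (j - l)\<bar>
        \<le> real (k - i + (j - l) choose (k - i)) * fps_nth \<psi> (k - i + (j - l))"
    proof (cases "l = 0")
      case False
      then have "j - l < J - 1" using j that by auto
      then show ?thesis using B unfolding majorized_def by blast
    qed (use j in \<open>auto simp: majorized_def\<close>)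
    moreover have "\<bar>coeff (fps_nth A i) l\<bar> \<le> real (i + l choose i) * fps_nth \<phi> (i + l)"
      using A j that by (auto simp: majorized_def)
    ultimately show ?thesis
      unfolding abs_mult
      by (intro mult_mono) (use nonneg in \<open>auto simp: nonneg_fps_def intro!: mult_nonneg_nonneg\<close>)
  qed
  have "\<bar>coeff (fps_nth (A * B) k) j\<bar>
      = \<bar>\<Sum>i\<le>k. \<Sum>l\<le>j. coeff (fps_nth A i) l * coeff (fps_nth B (k - i)) (j - l)\<bar>"
    by (simp add: fps_mult_nth coeff_sum coeff_mult atLeast0AtMost)
  also have "\<dots> \<le> (\<Sum>i\<le>k. \<Sum>l\<le>j. ?rhs i l)"
    by (intro order_trans[OF sum_abs] sum_mono bound) auto
  also have "\<dots> = real (k + j choose k) * (\<Sum>s\<le>k + j. fps_nth \<phi> s * fps_nth \<psi> (k + j - s))"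
    by (rule binomial_convolution)
  finally show "\<bar>coeff (fps_nth (A * B) k) j\<bar> \<le> real (k + j choose k) * fps_nth (\<phi> * \<psi>) (k + j)"
    by (simp add: fps_mult_nth atLeast0AtMost)
qed

text \<open>
  The majorant argument for the Cauchy problem with data on \<open>y = 0\<close>. If \<open>g\<close> is majorized up to
  some degree in \<open>y\<close>, then so is, one degree lower, the right-hand side of the equation: \<open>g\<^sub>y\<close>
  loses one degree, and \<open>g\<^sub>y\<^sub>y\<close>, which loses two, is multiplied by a series without constant
  term in \<open>y\<close>. Replacing each derivative by the corresponding derivative of \<open>\<phi>\<close> gives the
  left-hand side of the assumed inequality. Hence \<open>g\<^sub>y\<^sub>y\<close> is dominated by \<open>\<phi>''(x + y)\<close>, and
  integrating twice gains one degree.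
\<close>

lemma majorized_of_pde:
  fixes G :: "real poly fps" and \<phi> :: "real fps"
  defines "Gx \<equiv> fps_deriv G" and "Gy \<equiv> fps_dy G"
  defines "Gxx \<equiv> fps_deriv Gx" and "Gxy \<equiv> fps_dy Gx" and "Gyy \<equiv> fps_dy Gy"
  defines "\<Phi> \<equiv> fps_deriv \<phi>"
  defines "\<Phi>' \<equiv> fps_deriv \<Phi>"
  assumes pde: "Gyy = 2 * (Gy * Gxx) - 2 * (Gx * Gxy) + Gy * (Gy * Gxx) - 2 * (Gy * (Gxy * Gx))
      + Gx * (Gx * Gyy)"
    and init: "\<And>k. coeff (fps_nth G k) 0 = 0" "\<And>k. \<bar>coeff (fps_nth G k) 1\<bar> \<le> fps_nth \<Phi> k"
    and nonneg: "nonneg_fps \<phi>"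
    and maj: "\<And>n. fps_nth (2 * (\<Phi> * \<Phi>') + 2 * (\<Phi> * \<Phi>') + \<Phi> * (\<Phi> * \<Phi>') + 2 * (\<Phi> * (\<Phi>' * \<Phi>))
      + \<Phi> * (\<Phi> * \<Phi>')) n \<le> fps_nth \<Phi>' n"
  shows "majorized J G \<phi>"
proof -
  have nn: "nonneg_fps \<Phi>" "nonneg_fps \<Phi>'"
    unfolding \<Phi>'_def \<Phi>_def by (intro nonneg_fps_deriv nonneg)+
  have y0: "\<bar>coeff (fps_nth G k) 0\<bar> \<le> fps_nth \<phi> k" for k
    using init(1) nonneg by (simp add: nonneg_fps_def)
  have y1: "\<bar>coeff (fps_nth Gy k) 0\<bar> \<le> fps_nth \<Phi> k" for k
    using init(2)[of k] by (simp add: Gy_def coeff_pderiv)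
  have Gx0: "coeff (fps_nth Gx k) 0 = 0" for k
    using init(1)[of "Suc k"] by (simp add: Gx_def of_nat_poly)
  have step: "majorized (Suc (Suc J)) G \<phi>" for J
  proof (induction J)
    case 0
    show ?case
      unfolding majorized_Suc_iff[of _ G] using y0 y1
      by (auto simp: majorized_Suc_iff Gy_def[symmetric] \<Phi>_def[symmetric]) (simp add: majorized_def)
  next
    case (Suc J)
    have Gx2: "majorized (Suc (Suc J)) Gx \<Phi>"
      unfolding Gx_def \<Phi>_def by (rule majorized_fps_deriv[OF Suc])
    have Gx: "majorized (Suc J) Gx \<Phi>"
      using Gx2 by (rule majorized_antimono) simp
    have Gy: "majorized (Suc J) Gy \<Phi>"
      using Suc unfolding majorized_Suc_iff[of _ G] Gy_def \<Phi>_def by simp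
    have Gxx: "majorized (Suc J) Gxx \<Phi>'"
      unfolding Gxx_def \<Phi>'_def by (rule majorized_fps_deriv[OF Gx])
    have Gxy: "majorized (Suc J) Gxy \<Phi>'"
      using Gx2 unfolding majorized_Suc_iff[of _ Gx] Gxy_def \<Phi>'_def by simp
    have Gyy: "majorized J Gyy \<Phi>'"
      using Gy unfolding majorized_Suc_iff[of _ Gy] Gyy_def \<Phi>'_def by simp
    have prod: "majorized (Suc J) (A * B) (\<alpha> * \<beta>)"
      if "majorized (Suc J) A \<alpha>" "majorized (Suc J) B \<beta>" "nonneg_fps \<alpha>" "nonneg_fps \<beta>" for A B \<alpha> \<beta>
      using that by (intro majorized_mult) (auto intro: majorized_antimono)
    have last: "majorized (Suc J) (Gx * Gyy) (\<Phi> * \<Phi>')"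
      using Gx Gyy Gx0 nn by (intro majorized_mult) auto
    have "majorized (Suc J) Gyy (2 * (\<Phi> * \<Phi>') + 2 * (\<Phi> * \<Phi>') + \<Phi> * (\<Phi> * \<Phi>') + 2 * (\<Phi> * (\<Phi>' * \<Phi>))
        + \<Phi> * (\<Phi> * \<Phi>'))"
      by (subst pde)
        (intro majorized_add majorized_diff majorized_double prod nonneg_fps_mult nn Gx Gy Gxx Gxy last)
    then have "majorized (Suc J) Gyy \<Phi>'"
      unfolding majorized_def
      by (blast intro: order_trans mult_left_mono[OF maj of_nat_0_le_iff])
    then have "majorized (Suc (Suc J)) Gy \<Phi>"
      unfolding majorized_Suc_iff[of _ Gy] Gyy_def \<Phi>'_def using y1 by simp
    then show ?case
      unfolding majorized_Suc_iff[of _ G] Gy_def \<Phi>_def using y0 by simp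
  qed
  show ?thesis
    by (rule majorized_antimono[OF step[of J]]) simp
qed

lemma sum_inverse_squares_le: "(\<Sum>i\<le>n. 1 / (real (i + 1))\<^sup>2) \<le> 2 - 1 / real (n + 1)"
proof (induction n)
  case (Suc n)
  have "1 / (real (Suc n + 1))\<^sup>2 \<le> 1 / (real (n + 1) * real (Suc n + 1))"
    unfolding power2_eq_square by (intro divide_left_mono mult_right_mono) auto
  also have "\<dots> = 1 / real (n + 1) - 1 / real (Suc n + 1)"
    by (simp add: field_simps)
  finally show ?case using Suc by simp
qed simp

text \<open>
  With \<open>a = i + 1\<close> and \<open>b = n - i + 1\<close>, the sum \<open>a + b = n + 2\<close> does not depend on \<open>i\<close>, and
  \<open>1 / (a b) = (1 / a + 1 / b) / (a + b)\<close>.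
\<close>

lemma inverse_squares_convolution:
  "(\<Sum>i\<le>n. 1 / (real (i + 1))\<^sup>2 * (1 / (real (n - i + 1))\<^sup>2)) \<le> 8 / (real (n + 1))\<^sup>2"
proof -
  have "1 / (real (i + 1))\<^sup>2 * (1 / (real (n - i + 1))\<^sup>2)
      \<le> 2 / (real (n + 2))\<^sup>2 * (1 / (real (i + 1))\<^sup>2 + 1 / (real (n - i + 1))\<^sup>2)"
    if "i \<le> n" for i
  proof -
    define a b where "a = real (i + 1)" and "b = real (n - i + 1)"
    have pos: "a > 0" "b > 0" and ab: "real (n + 2) = a + b"
      using that by (auto simp: a_def b_def)
    have "1 / a\<^sup>2 * (1 / b\<^sup>2) = (1 / (a + b))\<^sup>2 * (1 / a + 1 / b)\<^sup>2"
    proof -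
      have "1 / a + 1 / b = (a + b) / (a * b)" "a + b \<noteq> 0"
        using pos by (simp_all add: field_simps)
      then show ?thesis by (simp add: power_divide power_mult_distrib)
    qed
    also have "\<dots> \<le> (1 / (a + b))\<^sup>2 * (2 * (1 / a\<^sup>2 + 1 / b\<^sup>2))"
      using sum_squares_bound[of "1 / a" "1 / b"]
      by (intro mult_left_mono zero_le_power2) (simp add: power2_sum power_divide)
    finally show ?thesis
      unfolding a_def[symmetric] b_def[symmetric] ab by (simp add: power_divide)
  qed
  then have "(\<Sum>i\<le>n. 1 / (real (i + 1))\<^sup>2 * (1 / (real (n - i + 1))\<^sup>2))
      \<le> (\<Sum>i\<le>n. 2 / (real (n + 2))\<^sup>2 * (1 / (real (i + 1))\<^sup>2 + 1 / (real (n - i + 1))\<^sup>2))"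
    by (intro sum_mono) auto
  also have "\<dots> = 2 / (real (n + 2))\<^sup>2 * ((\<Sum>i\<le>n. 1 / (real (i + 1))\<^sup>2) + (\<Sum>i\<le>n. 1 / (real (n - i + 1))\<^sup>2))"
    by (simp only: sum.distrib sum_distrib_left distrib_left)
  also have "(\<Sum>i\<le>n. 1 / (real (n - i + 1))\<^sup>2) = (\<Sum>i\<le>n. 1 / (real (i + 1))\<^sup>2)"
    by (rule sum.reindex_bij_witness[of _ "\<lambda>i. n - i" "\<lambda>i. n - i"]) auto
  also have "2 / (real (n + 2))\<^sup>2 * ((\<Sum>i\<le>n. 1 / (real (i + 1))\<^sup>2) + (\<Sum>i\<le>n. 1 / (real (i + 1))\<^sup>2))
      \<le> 2 / (real (n + 2))\<^sup>2 * (2 + 2)"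
  proof -
    have "(\<Sum>i\<le>n. 1 / (real (i + 1))\<^sup>2) \<le> 2"
      using sum_inverse_squares_le[of n] by (rule order_trans) simp
    then show ?thesis by (intro mult_left_mono add_mono) auto
  qed
  also have "\<dots> \<le> 8 / (real (n + 1))\<^sup>2"
    by (simp add: frac_le power_mono)
  finally show ?thesis .
qed

text \<open>
  The derivative \<open>\<phi>'\<close> of the majorant. Its coefficients are inverse squares, up to scaling the
  variable by \<open>R\<close>, so its square is bounded by a multiple of itself. The factor \<open>24\<close> makes this
  multiple \<open>8 / 24 = 1 / 3\<close>, uniformly in \<open>R\<close>.
\<close>

definition slope_majorant :: "real \<Rightarrow> real fps" where
  "slope_majorant R = Abs_fps (\<lambda>n. R ^ n / (24 * (real (n + 1))\<^sup>2))"

lemma slope_majorant_square: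
  assumes "R \<ge> 0"
  shows "fps_nth (slope_majorant R * slope_majorant R) n \<le> fps_nth (slope_majorant R) n / 3"
proof -
  have "fps_nth (slope_majorant R * slope_majorant R) n
      = (\<Sum>i\<le>n. R ^ n / 576 * (1 / (real (i + 1))\<^sup>2 * (1 / (real (n - i + 1))\<^sup>2)))"
    unfolding fps_mult_nth slope_majorant_def atLeast0AtMost
  proof (rule sum.cong[OF refl])
    fix i assume "i \<in> {..n}"
    then have "R ^ n = R ^ i * R ^ (n - i)" by (simp flip: power_add)
    then show "fps_nth (Abs_fps (\<lambda>n. R ^ n / (24 * (real (n + 1))\<^sup>2))) i
        * fps_nth (Abs_fps (\<lambda>n. R ^ n / (24 * (real (n + 1))\<^sup>2))) (n - i)
        = R ^ n / 576 * (1 / (real (i + 1))\<^sup>2 * (1 / (real (n - i + 1))\<^sup>2))"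
      by simp
  qed
  also have "\<dots> = R ^ n / 576 * (\<Sum>i\<le>n. 1 / (real (i + 1))\<^sup>2 * (1 / (real (n - i + 1))\<^sup>2))"
    by (simp only: sum_distrib_left)
  also have "\<dots> \<le> R ^ n / 576 * (8 / (real (n + 1))\<^sup>2)"
    using assms by (intro mult_left_mono inverse_squares_convolution) auto
  also have "\<dots> = fps_nth (slope_majorant R) n / 3"
    by (simp add: slope_majorant_def)
  finally show ?thesis .
qed

lemma slope_majorant_nonneg: "R \<ge> 0 \<Longrightarrow> nonneg_fps (slope_majorant R)"
  by (simp add: nonneg_fps_def slope_majorant_def)

lemma slope_majorant_cube:
  assumes "R \<ge> 0"
  shows "fps_nth (slope_majorant R * (slope_majorant R * slope_majorant R)) n
    \<le> fps_nth (slope_majorant R) n / 9"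
proof -
  let ?\<Phi> = "slope_majorant R"
  have nn: "0 \<le> fps_nth ?\<Phi> i" for i
    using slope_majorant_nonneg[OF assms] by (simp add: nonneg_fps_def)
  have "fps_nth (?\<Phi> * (?\<Phi> * ?\<Phi>)) n \<le> (\<Sum>i=0..n. fps_nth ?\<Phi> i * (fps_nth ?\<Phi> (n - i) / 3))"
    unfolding fps_mult_nth[of ?\<Phi> "?\<Phi> * ?\<Phi>"]
    by (intro sum_mono mult_left_mono slope_majorant_square assms nn)
  also have "\<dots> = fps_nth (?\<Phi> * ?\<Phi>) n / 3"
    by (simp add: fps_mult_nth sum_divide_distrib)
  also have "\<dots> \<le> fps_nth ?\<Phi> n / 9"
    using slope_majorant_square[OF assms, of n] by simp
  finally show ?thesis .
qed

text \<open>
  The left-hand side is \<open>4 \<Phi> \<Phi>' + 4 \<Phi>\<^sup>2 \<Phi>'\<close>, the derivative of \<open>2 \<Phi>\<^sup>2 + 4/3 \<Phi>\<^sup>3\<close>. Since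
  \<open>\<Phi>\<^sup>2 \<le> \<Phi> / 3\<close> and \<open>\<Phi>\<^sup>3 \<le> \<Phi> / 9\<close> coefficientwise, it is at most
  \<open>2/3 + 4/27 < 1\<close> times \<open>\<Phi>'\<close>.
\<close>

lemma slope_majorant_ineq:
  assumes "R \<ge> 0"
  defines "\<Phi> \<equiv> slope_majorant R"
  defines "\<Phi>' \<equiv> fps_deriv \<Phi>"
  shows "fps_nth (2 * (\<Phi> * \<Phi>') + 2 * (\<Phi> * \<Phi>') + \<Phi> * (\<Phi> * \<Phi>') + 2 * (\<Phi> * (\<Phi>' * \<Phi>))
      + \<Phi> * (\<Phi> * \<Phi>')) n \<le> fps_nth \<Phi>' n"
proof -
  have "2 * (\<Phi> * \<Phi>') + 2 * (\<Phi> * \<Phi>') + \<Phi> * (\<Phi> * \<Phi>') + 2 * (\<Phi> * (\<Phi>' * \<Phi>)) + \<Phi> * (\<Phi> * \<Phi>')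
      = fps_const 2 * fps_deriv (\<Phi> * \<Phi>) + fps_const (4/3) * fps_deriv (\<Phi> * (\<Phi> * \<Phi>))"
  proof -
    have three: "\<Phi> * (\<Phi> * \<Phi>') = fps_const (1/3) * fps_deriv (\<Phi> * (\<Phi> * \<Phi>))"
    proof -
      have "fps_deriv (\<Phi> * (\<Phi> * \<Phi>)) = fps_const 3 * (\<Phi> * (\<Phi> * \<Phi>'))"
        unfolding \<Phi>'_def by (simp add: algebra_simps flip: numeral_fps_const)
      then have "fps_const (1/3) * fps_deriv (\<Phi> * (\<Phi> * \<Phi>)) = fps_const (1/3) * (fps_const 3 * (\<Phi> * (\<Phi> * \<Phi>')))"
        by (simp only:)
      also have "\<dots> = \<Phi> * (\<Phi> * \<Phi>')"
        by (rule fps_ext) simp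
      finally show ?thesis ..
    qed
    have "2 * (\<Phi> * \<Phi>') + 2 * (\<Phi> * \<Phi>') + \<Phi> * (\<Phi> * \<Phi>') + 2 * (\<Phi> * (\<Phi>' * \<Phi>)) + \<Phi> * (\<Phi> * \<Phi>')
        = fps_const 2 * fps_deriv (\<Phi> * \<Phi>) + fps_const 4 * (\<Phi> * (\<Phi> * \<Phi>'))"
      unfolding \<Phi>'_def by (simp add: algebra_simps flip: numeral_fps_const)
    also have "fps_const 4 * (\<Phi> * (\<Phi> * \<Phi>')) = fps_const (4/3) * fps_deriv (\<Phi> * (\<Phi> * \<Phi>))"
      unfolding three by (simp flip: mult.assoc)
    finally show ?thesis .
  qed
  then have "fps_nth (2 * (\<Phi> * \<Phi>') + 2 * (\<Phi> * \<Phi>') + \<Phi> * (\<Phi> * \<Phi>') + 2 * (\<Phi> * (\<Phi>' * \<Phi>)) + \<Phi> * (\<Phi> * \<Phi>')) n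
      = real (n + 1) * (2 * fps_nth (\<Phi> * \<Phi>) (n + 1) + 4/3 * fps_nth (\<Phi> * (\<Phi> * \<Phi>)) (n + 1))"
    by (simp only: fps_add_nth fps_mult_left_const_nth fps_deriv_nth) (simp add: algebra_simps)
  also have "\<dots> \<le> real (n + 1) * fps_nth \<Phi> (n + 1)"
    using slope_majorant_square[OF assms(1), of "n + 1"] slope_majorant_cube[OF assms(1), of "n + 1"]
      slope_majorant_nonneg[OF assms(1)]
    unfolding \<Phi>_def nonneg_fps_def by (intro mult_left_mono) (auto dest: spec[of _ "n + 1"])
  finally show ?thesis by (simp add: \<Phi>'_def)
qed

lemma zmc_fps_geometric_bound:
  "\<exists>Q>0. \<forall>k j. \<bar>coeff (fps_nth (zmc_fps c) k) j\<bar> \<le> Q ^ (k + j)"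
proof -
  \<comment> \<open>The initial slope is \<open>c x\<^sup>3\<close>, and the coefficient of \<open>x\<^sup>3\<close> in \<open>\<phi>'\<close> is \<open>R\<^sup>3 / (24 \<cdot> 16)\<close>.\<close>
  define R where "R = max 1 (384 * \<bar>c\<bar>)"
  have R1: "R \<ge> 1" and Rc: "384 * \<bar>c\<bar> \<le> R" by (auto simp: R_def)
  then have R0: "R \<ge> 0" by simp
  define \<phi> where "\<phi> = fps_integral0 (slope_majorant R)"
  have d\<phi>: "fps_deriv \<phi> = slope_majorant R"
    unfolding \<phi>_def by (rule fps_deriv_fps_integral)
  have nn: "nonneg_fps \<phi>"
    using slope_majorant_nonneg[OF R0] by (auto simp: nonneg_fps_def \<phi>_def fps_integral_def)
  have maj: "majorized J (zmc_fps c) \<phi>" for J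
  proof (rule majorized_of_pde[OF zmc_fps_pde])
    fix k
    show "coeff (fps_nth (zmc_fps c) k) 0 = 0" by (simp add: coeff_zmc_poly)
    have "384 * \<bar>c\<bar> \<le> R ^ 3"
      using Rc power_increasing[of 1 3 R] R1 by simp
    then show "\<bar>coeff (fps_nth (zmc_fps c) k) 1\<bar> \<le> fps_nth (fps_deriv \<phi>) k"
      using slope_majorant_nonneg[OF R0]
      unfolding d\<phi> zmc_fps_nth coeff_smult coeff_zmc_poly by (auto simp: slope_majorant_def nonneg_fps_def)
  qed (use nn slope_majorant_ineq[OF R0] in \<open>simp_all only: d\<phi>\<close>)
  have \<phi>_le: "fps_nth \<phi> n \<le> R ^ n" for n
  proof (cases n)
    case (Suc m)
    have "fps_nth \<phi> n = R ^ m / ((24 * (real (m + 1))\<^sup>2) * real (m + 1))"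
      by (simp add: Suc \<phi>_def fps_integral_def slope_majorant_def field_simps)
    also have "\<dots> \<le> R ^ m / 1"
    proof (rule divide_left_mono)
      have "1 * 1 \<le> (24 * (real (m + 1))\<^sup>2) * real (m + 1)"
        by (intro mult_mono) (auto simp: power2_eq_square algebra_simps)
      then show "1 \<le> (24 * (real (m + 1))\<^sup>2) * real (m + 1)" by simp
    qed (use R0 in auto)
    also have "\<dots> \<le> R ^ n" using R1 Suc by (simp add: power_increasing)
    finally show ?thesis .
  qed (simp add: \<phi>_def fps_integral_def)
  have "\<bar>coeff (fps_nth (zmc_fps c) k) j\<bar> \<le> (2 * R) ^ (k + j)" for k j
  proof -
    have "\<bar>coeff (fps_nth (zmc_fps c) k) j\<bar> \<le> real (k + j choose k) * fps_nth \<phi> (k + j)"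
      using maj[of "Suc j"] unfolding majorized_def by blast
    also have "\<dots> \<le> 2 ^ (k + j) * R ^ (k + j)"
    proof (intro mult_mono \<phi>_le)
      show "real (k + j choose k) \<le> 2 ^ (k + j)"
        using binomial_le_pow2[of "k + j" k] by (metis of_nat_le_iff of_nat_numeral of_nat_power)
    qed (use nn in \<open>auto simp: nonneg_fps_def\<close>)
    finally show ?thesis by (simp add: power_mult_distrib)
  qed
  then show ?thesis using R1 by (intro exI[of _ "2 * R"]) auto
qed

section \<open>Evaluation of formal series in two variables\<close>

definition fps_at :: "real poly fps \<Rightarrow> real \<Rightarrow> real fps" where
  "fps_at A y = Abs_fps (\<lambda>k. poly (fps_nth A k) y)"

lemma fps_at_nth [simp]: "fps_nth (fps_at A y) k = poly (fps_nth A k) y"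
  by (simp add: fps_at_def)

lemma fps_at_simps:
  "fps_at (A + B) y = fps_at A y + fps_at B y"
  "fps_at (A - B) y = fps_at A y - fps_at B y"
  "fps_at (A * B) y = fps_at A y * fps_at B y"
  "fps_at 1 y = 1"
  "fps_at (fps_deriv A) y = fps_deriv (fps_at A y)"
  by (rule fps_ext; simp add: fps_mult_nth poly_sum of_nat_poly fps_one_nth)+

text \<open>
  Evaluation passes through the power series in \<open>x\<close> alone, with \<open>y\<close> fixed: products and
  derivatives in \<open>x\<close> are then those of univariate power series.
\<close>

definition ev :: "real poly fps \<Rightarrow> real \<Rightarrow> real \<Rightarrow> real" where
  "ev A x y = eval_fps (fps_at A y) x"

definition converges_at :: "real poly fps \<Rightarrow> real \<Rightarrow> real \<Rightarrow> bool" where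
  "converges_at A x y \<longleftrightarrow> ereal \<bar>x\<bar> < fps_conv_radius (fps_at A y)"

lemma less_min_le_trans: "(a :: ereal) < b \<Longrightarrow> a < c \<Longrightarrow> min b c \<le> d \<Longrightarrow> a < d"
  by (metis min_less_iff_conj less_le_trans)

lemma ev_add:
  assumes "converges_at A x y" "converges_at B x y"
  shows "converges_at (A + B) x y" "ev (A + B) x y = ev A x y + ev B x y"
  using assms fps_conv_radius_add[of "fps_at A y" "fps_at B y"]
  by (auto simp: converges_at_def ev_def fps_at_simps eval_fps_add intro: less_min_le_trans)

lemma ev_diff:
  assumes "converges_at A x y" "converges_at B x y"
  shows "converges_at (A - B) x y" "ev (A - B) x y = ev A x y - ev B x y"
  using assms fps_conv_radius_diff[of "fps_at A y" "fps_at B y"]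
  by (auto simp: converges_at_def ev_def fps_at_simps eval_fps_diff intro: less_min_le_trans)

lemma ev_mult:
  assumes "converges_at A x y" "converges_at B x y"
  shows "converges_at (A * B) x y" "ev (A * B) x y = ev A x y * ev B x y"
  using assms fps_conv_radius_mult[of "fps_at A y" "fps_at B y"]
  by (auto simp: converges_at_def ev_def fps_at_simps eval_fps_mult intro: less_min_le_trans)

lemma ev_1: "converges_at 1 x y" "ev 1 x y = 1"
  by (simp_all add: converges_at_def ev_def fps_at_simps)

lemma pdx_ev: "converges_at A x y \<Longrightarrow> pdx (ev A) x y = ev (fps_deriv A) x y"
  unfolding pdx_def ev_def fps_at_simps
  by (intro DERIV_imp_deriv has_field_derivative_eval_fps) (simp add: converges_at_def)

lemma pdx_cong:
  assumes "open U" "(x, y) \<in> U" "\<And>x y. (x, y) \<in> U \<Longrightarrow> f x y = g x y"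
  shows "pdx f x y = pdx g x y"
proof -
  have "open ((\<lambda>s. (s, y)) -` U)"
    by (intro open_vimage assms continuous_intros)
  then have "\<forall>\<^sub>F s in nhds x. f s y = g s y"
    using assms by (intro eventually_nhds[THEN iffD2] exI[of _ "(\<lambda>s. (s, y)) -` U"]) auto
  then show ?thesis unfolding pdx_def by (rule deriv_cong_ev) simp
qed

lemma pdy_cong:
  assumes "open U" "(x, y) \<in> U" "\<And>x y. (x, y) \<in> U \<Longrightarrow> f x y = g x y"
  shows "pdy f x y = pdy g x y"
proof -
  have "open ((\<lambda>s. (x, s)) -` U)"
    by (intro open_vimage assms continuous_intros)
  then have "\<forall>\<^sub>F s in nhds y. f x s = g x s"
    using assms by (intro eventually_nhds[THEN iffD2] exI[of _ "(\<lambda>s. (x, s)) -` U"]) auto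
  then show ?thesis unfolding pdy_def by (rule deriv_cong_ev) simp
qed


section \<open>Geometric coefficient bounds\<close>

text \<open>
  The form of the estimate from which convergence is derived. It is stable under partial
  derivatives if \<open>Q\<close> is doubled, since \<open>n + 1 \<le> 2\<^sup>n\<close>.
\<close>

definition geometric :: "real \<Rightarrow> real poly fps \<Rightarrow> bool" where
  "geometric Q A \<longleftrightarrow> (\<exists>M. \<forall>k j. \<bar>coeff (fps_nth A k) j\<bar> \<le> M * Q ^ (k + j))"

lemma geometricE:
  assumes "geometric Q A"
  obtains M where "M \<ge> 0" "\<And>k j. \<bar>coeff (fps_nth A k) j\<bar> \<le> M * Q ^ (k + j)"
proof -
  obtain M where M: "\<And>k j. \<bar>coeff (fps_nth A k) j\<bar> \<le> M * Q ^ (k + j)"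
    using assms by (auto simp: geometric_def)
  have "0 \<le> M" using M[of 0 0] by (simp add: order_trans[OF abs_ge_zero])
  then show ?thesis using M that by blast
qed

lemma geometric_mono:
  assumes "geometric Q A" "0 \<le> Q" "Q \<le> Q'"
  shows "geometric Q' A"
proof -
  obtain M where M: "M \<ge> 0" "\<And>k j. \<bar>coeff (fps_nth A k) j\<bar> \<le> M * Q ^ (k + j)"
    using geometricE[OF assms(1)] by blast
  have "\<bar>coeff (fps_nth A k) j\<bar> \<le> M * Q' ^ (k + j)" for k j
    using M(1) assms by (intro order_trans[OF M(2)] mult_left_mono power_mono) auto
  then show ?thesis by (auto simp: geometric_def)
qed

lemma geometric_add:
  assumes "geometric Q A" "geometric Q B"
  shows "geometric Q (A + B)"
proof -
  obtain M where M: "\<And>k j. \<bar>coeff (fps_nth A k) j\<bar> \<le> M * Q ^ (k + j)"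
    using assms by (auto simp: geometric_def)
  obtain N where N: "\<And>k j. \<bar>coeff (fps_nth B k) j\<bar> \<le> N * Q ^ (k + j)"
    using assms by (auto simp: geometric_def)
  have "\<bar>coeff (fps_nth (A + B) k) j\<bar> \<le> (M + N) * Q ^ (k + j)" for k j
    using M[of k j] N[of k j] by (simp add: algebra_simps)
  then show ?thesis by (auto simp: geometric_def)
qed

lemma Suc_le_two_power: "real (Suc n) \<le> 2 ^ (n + m)"
proof -
  have "Suc n \<le> 2 ^ n" by (simp add: Suc_leI less_exp)
  then have "real (Suc n) \<le> 2 ^ n" by (metis of_nat_le_iff of_nat_numeral of_nat_power)
  also have "\<dots> \<le> 2 ^ (n + m)" by (rule power_increasing) auto
  finally show ?thesis .
qed

lemma geometric_fps_deriv:
  assumes "geometric Q A" "0 \<le> Q"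
  shows "geometric (2 * Q) (fps_deriv A)"
proof -
  obtain M where M: "M \<ge> 0" "\<And>k j. \<bar>coeff (fps_nth A k) j\<bar> \<le> M * Q ^ (k + j)"
    using geometricE[OF assms(1)] by blast
  have "\<bar>coeff (fps_nth (fps_deriv A) k) j\<bar> \<le> (M * Q) * (2 * Q) ^ (k + j)" for k j
  proof -
    have "\<bar>coeff (fps_nth (fps_deriv A) k) j\<bar> = real (Suc k) * \<bar>coeff (fps_nth A (Suc k)) j\<bar>"
      by (simp add: of_nat_poly abs_mult del: of_nat_Suc)
    also have "\<dots> \<le> 2 ^ (k + j) * (M * Q ^ (Suc k + j))"
      by (intro mult_mono Suc_le_two_power M(2)) auto
    also have "\<dots> = (M * Q) * (2 * Q) ^ (k + j)"
      by (simp add: power_mult_distrib)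
    finally show ?thesis .
  qed
  then show ?thesis unfolding geometric_def by blast
qed

lemma geometric_fps_dy:
  assumes "geometric Q A" "0 \<le> Q"
  shows "geometric (2 * Q) (fps_dy A)"
proof -
  obtain M where M: "M \<ge> 0" "\<And>k j. \<bar>coeff (fps_nth A k) j\<bar> \<le> M * Q ^ (k + j)"
    using geometricE[OF assms(1)] by blast
  have "\<bar>coeff (fps_nth (fps_dy A) k) j\<bar> \<le> (M * Q) * (2 * Q) ^ (k + j)" for k j
  proof -
    have "\<bar>coeff (fps_nth (fps_dy A) k) j\<bar> = real (Suc j) * \<bar>coeff (fps_nth A k) (Suc j)\<bar>"
      by (simp add: coeff_pderiv abs_mult)
    also have "\<dots> \<le> 2 ^ (j + k) * (M * Q ^ (k + Suc j))"
      by (intro mult_mono Suc_le_two_power M(2)) auto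
    also have "\<dots> = (M * Q) * (2 * Q) ^ (k + j)"
      by (simp add: power_mult_distrib add.commute)
    finally show ?thesis .
  qed
  then show ?thesis unfolding geometric_def by blast
qed

lemma abs_poly_le:
  fixes p :: "real poly"
  assumes p: "\<And>j. \<bar>coeff p j\<bar> \<le> B * Q ^ j" and y: "Q * \<bar>y\<bar> \<le> 1/2" and "B \<ge> 0" "Q \<ge> 0"
  shows "\<bar>poly p y\<bar> \<le> 2 * B"
proof -
  have "\<bar>poly p y\<bar> \<le> (\<Sum>j\<le>degree p. \<bar>coeff p j\<bar> * \<bar>y\<bar> ^ j)"
    unfolding poly_altdef by (rule order_trans[OF sum_abs]) (simp add: abs_mult power_abs)
  also have "\<dots> \<le> (\<Sum>j\<le>degree p. B * (1/2) ^ j)"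
  proof (rule sum_mono)
    fix j
    have "\<bar>coeff p j\<bar> * \<bar>y\<bar> ^ j \<le> (B * Q ^ j) * \<bar>y\<bar> ^ j"
      by (intro mult_right_mono p) auto
    also have "\<dots> = B * (Q * \<bar>y\<bar>) ^ j" by (simp add: power_mult_distrib)
    also have "\<dots> \<le> B * (1/2) ^ j"
      using assms by (intro mult_left_mono power_mono) auto
    finally show "\<bar>coeff p j\<bar> * \<bar>y\<bar> ^ j \<le> B * (1/2) ^ j" .
  qed
  also have "\<dots> = B * (\<Sum>j\<le>degree p. (1/2) ^ j)" by (simp only: sum_distrib_left)
  also have "\<dots> \<le> B * 2"
  proof (rule mult_left_mono)
    show "(\<Sum>j\<le>degree p. (1/2 :: real) ^ j) \<le> 2"
      using sum_le_suminf[of "\<lambda>j. (1/2 :: real) ^ j" "{..degree p}"] suminf_geometric[of "1/2 :: real"]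
      by (simp add: summable_geometric)
  qed fact
  finally show ?thesis by simp
qed

lemma geometric_poly_bound:
  assumes "geometric Q A" "Q > 0"
  obtains M where "M \<ge> 0" "\<And>k y. \<bar>y\<bar> \<le> 1 / (2 * Q) \<Longrightarrow> \<bar>poly (fps_nth A k) y\<bar> \<le> M * Q ^ k"
proof -
  obtain M where M: "M \<ge> 0" "\<And>k j. \<bar>coeff (fps_nth A k) j\<bar> \<le> M * Q ^ (k + j)"
    using geometricE[OF assms(1)] by blast
  have "\<bar>poly (fps_nth A k) y\<bar> \<le> 2 * (M * Q ^ k)" if "\<bar>y\<bar> \<le> 1 / (2 * Q)" for k y
  proof (rule abs_poly_le[of _ _ Q])
    show "\<bar>coeff (fps_nth A k) j\<bar> \<le> M * Q ^ k * Q ^ j" for j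
      using M(2)[of k j] by (simp add: power_add mult.assoc)
    show "Q * \<bar>y\<bar> \<le> 1/2" using that assms(2) by (simp add: field_simps)
  qed (use M(1) assms(2) in auto)
  then show ?thesis using M(1) by (intro that[of "2 * M"]) (auto simp: mult.assoc)
qed

lemma geometric_term_bound:
  fixes x :: real
  assumes "\<bar>a\<bar> \<le> M * Q ^ k" "\<bar>x\<bar> \<le> 1 / (2 * Q)" "Q > 0" "M \<ge> 0"
  shows "\<bar>a * x ^ k\<bar> \<le> M * (1/2) ^ k"
proof -
  have "\<bar>a * x ^ k\<bar> = \<bar>a\<bar> * \<bar>x\<bar> ^ k" by (simp add: abs_mult power_abs)
  also have "\<dots> \<le> (M * Q ^ k) * (1 / (2 * Q)) ^ k"
    using assms by (intro mult_mono power_mono) auto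
  also have "\<dots> = M * (Q * (1 / (2 * Q))) ^ k" by (simp only: power_mult_distrib mult.assoc)
  also have "Q * (1 / (2 * Q)) = 1/2" using assms by simp
  finally show ?thesis .
qed

lemma geometric_summable:
  assumes "geometric Q A" "Q > 0" "\<bar>x\<bar> \<le> 1 / (2 * Q)" "\<bar>y\<bar> \<le> 1 / (2 * Q)"
  shows "summable (\<lambda>k. \<bar>poly (fps_nth A k) y * x ^ k\<bar>)"
proof -
  obtain M where M: "M \<ge> 0" "\<And>k y. \<bar>y\<bar> \<le> 1 / (2 * Q) \<Longrightarrow> \<bar>poly (fps_nth A k) y\<bar> \<le> M * Q ^ k"
    using geometric_poly_bound[OF assms(1,2)] by blast
  show ?thesis
  proof (rule summable_comparison_test'[of "\<lambda>k. M * (1/2) ^ k" 0])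
    show "summable (\<lambda>k. M * (1/2 :: real) ^ k)" by (intro summable_mult summable_geometric) auto
  qed (use geometric_term_bound[OF M(2)[OF assms(4)] assms(3,2) M(1)] in auto)
qed

lemma geometric_converges_at:
  assumes "geometric Q A" "Q > 0" "\<bar>x\<bar> < 1 / (2 * Q)" "\<bar>y\<bar> < 1 / (2 * Q)"
  shows "converges_at A x y"
proof -
  have "summable (\<lambda>k. fps_nth (fps_at A y) k * (1 / (2 * Q)) ^ k)"
  proof (rule summable_rabs_cancel)
    show "summable (\<lambda>k. \<bar>fps_nth (fps_at A y) k * (1 / (2 * Q)) ^ k\<bar>)"
      unfolding fps_at_nth by (rule geometric_summable[OF assms(1,2)]) (use assms in auto)
  qed
  then have "ereal (norm (1 / (2 * Q))) \<le> fps_conv_radius (fps_at A y)"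
    unfolding fps_conv_radius_def by (rule conv_radius_geI)
  moreover have "ereal \<bar>x\<bar> < ereal (norm (1 / (2 * Q)))" using assms by simp
  ultimately show ?thesis unfolding converges_at_def by (rule less_le_trans[rotated])
qed

text \<open>
  Here the series in \<open>x\<close> is differentiated termwise with respect to the parameter \<open>y\<close>, which the
  Weierstrass test for the differentiated series permits.
\<close>

lemma pdy_ev:
  assumes "geometric Q A" "geometric Q (fps_dy A)" "Q > 0" "\<bar>x\<bar> < 1 / (2 * Q)" "\<bar>y\<bar> < 1 / (2 * Q)"
  shows "pdy (ev A) x y = ev (fps_dy A) x y"
proof -
  define S where "S = {- (1 / (2 * Q))<..<1 / (2 * Q)}"
  have S: "open S" "convex S" "y \<in> S" "\<And>s. s \<in> S \<Longrightarrow> \<bar>s\<bar> \<le> 1 / (2 * Q)"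
    using assms(5) unfolding S_def by (simp_all add: abs_less_iff abs_le_iff)
  obtain M where M: "M \<ge> 0"
    "\<And>k s. \<bar>s\<bar> \<le> 1 / (2 * Q) \<Longrightarrow> \<bar>poly (fps_nth (fps_dy A) k) s\<bar> \<le> M * Q ^ k"
    using geometric_poly_bound[OF assms(2,3)] by blast
  have "((\<lambda>s. \<Sum>k. poly (fps_nth A k) s * x ^ k) has_field_derivative
      (\<Sum>k. poly (pderiv (fps_nth A k)) y * x ^ k)) (at y)"
  proof (rule has_field_derivative_series'(2)[of S])
    show "uniformly_convergent_on S (\<lambda>n s. \<Sum>k<n. poly (pderiv (fps_nth A k)) s * x ^ k)"
    proof (rule Weierstrass_m_test'[where M = "\<lambda>k. M * (1/2) ^ k"])
      show "summable (\<lambda>k. M * (1/2 :: real) ^ k)" by (intro summable_mult summable_geometric) auto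
      show "norm (poly (pderiv (fps_nth A k)) s * x ^ k) \<le> M * (1/2) ^ k" if "s \<in> S" for k s
        using geometric_term_bound[OF M(2)[OF S(4)[OF that]] _ assms(3) M(1), of x k] assms(4) by simp
    qed
    show "y \<in> interior S" using S by (simp add: interior_open)
    show "summable (\<lambda>k. poly (fps_nth A k) y * x ^ k)"
      by (rule summable_rabs_cancel, rule geometric_summable[OF assms(1,3)]) (use assms(4,5) in auto)
    show "((\<lambda>s. poly (fps_nth A k) s * x ^ k) has_field_derivative
        poly (pderiv (fps_nth A k)) s * x ^ k) (at s within S)" for k s
      by (rule DERIV_cmult_right, rule has_field_derivative_at_within, rule poly_DERIV)
  qed (use S(2,3) in simp_all)
  then show ?thesis
    unfolding pdy_def ev_def eval_fps_def by (intro DERIV_imp_deriv) simp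
qed

lemma has_sum_poly:
  fixes p :: "real poly"
  shows "((\<lambda>j. coeff p j * y ^ j) has_sum poly p y) UNIV"
  by (rule has_sum_finite_neutralI[of "{..degree p}"]) (auto simp: poly_altdef coeff_eq_0 not_le)

lemma geometric_has_sum:
  assumes A: "geometric Q A" and Q: "Q > 0" and x: "\<bar>x\<bar> < 1 / (2 * Q)" and y: "\<bar>y\<bar> < 1 / (2 * Q)"
  shows "((\<lambda>(k, j). coeff (fps_nth A k) j * x ^ k * y ^ j) has_sum ev A x y) UNIV"
proof -
  let ?h = "\<lambda>(k, j). coeff (fps_nth A k) j * x ^ k * y ^ j"
  obtain M where M: "M \<ge> 0" "\<And>k j. \<bar>coeff (fps_nth A k) j\<bar> \<le> M * Q ^ (k + j)"
    using geometricE[OF A] by blast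
  have geo: "((\<lambda>j. (1/2 :: real) ^ j) has_sum 2) UNIV"
    using sums_nonneg_imp_has_sum[OF geometric_sums[of "1/2 :: real"]] by simp
  have "(\<lambda>(k, j). M * (1/2) ^ k * (1/2 :: real) ^ j) summable_on (UNIV \<times> UNIV)"
  proof (rule summable_on_SigmaI)
    show "((\<lambda>j. case (k, j) of (k, j) \<Rightarrow> M * (1/2) ^ k * (1/2 :: real) ^ j) has_sum (M * (1/2) ^ k) * 2) UNIV" for k
      using has_sum_cmult_right[OF geo] by simp
    show "(\<lambda>k. (M * (1/2 :: real) ^ k) * 2) summable_on UNIV"
      by (intro summable_on_cmult_left summable_on_cmult_right has_sum_imp_summable[OF geo])
  qed (use M(1) in auto)
  then have "(\<lambda>z. norm (?h z)) summable_on (UNIV \<times> UNIV)"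
  proof (rule Infinite_Sum.abs_summable_on_comparison_test')
    fix z :: "nat \<times> nat"
    obtain k j where z: "z = (k, j)" by (cases z)
    have "\<bar>coeff (fps_nth A k) j * y ^ j\<bar> \<le> (M * Q ^ k) * (1/2) ^ j"
      using M(2)[of k j] by (intro geometric_term_bound) (use M(1) Q y in \<open>auto simp: power_add mult.assoc\<close>)
    then have "\<bar>(coeff (fps_nth A k) j * y ^ j) * x ^ k\<bar> \<le> (M * (1/2) ^ j) * (1/2) ^ k"
      by (intro geometric_term_bound[of _ _ Q]) (use M(1) Q x in \<open>auto simp: mult_ac\<close>)
    then show "norm (?h z) \<le> (case z of (k, j) \<Rightarrow> M * (1/2) ^ k * (1/2) ^ j)"
      by (simp add: z mult_ac)
  qed
  then have summ: "?h summable_on (UNIV \<times> UNIV)"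
    by (rule abs_summable_summable)
  have "((\<lambda>k. poly (fps_nth A k) y * x ^ k) has_sum ev A x y) UNIV"
  proof (rule norm_summable_imp_has_sum)
    show s: "summable (\<lambda>k. norm (poly (fps_nth A k) y * x ^ k))"
      using geometric_summable[OF A Q, of x y] x y by simp
    show "(\<lambda>k. poly (fps_nth A k) y * x ^ k) sums ev A x y"
      using summable_norm_cancel[OF s] by (simp add: ev_def eval_fps_def summable_sums)
  qed
  then have "(?h has_sum ev A x y) (UNIV \<times> UNIV)"
  proof (rule has_sum_SigmaI[rotated])
    show "((\<lambda>j. ?h (k, j)) has_sum poly (fps_nth A k) y * x ^ k) UNIV" for k
      using has_sum_cmult_left[OF has_sum_poly[of "fps_nth A k" y], of "x ^ k"] by (simp add: mult_ac)
  qed (rule summ)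
  then show ?thesis by simp
qed

text \<open>
  A truncation of \<open>A\<close> below order \<open>n\<close> is \<open>O(x\<^sup>n)\<close>, uniformly in \<open>y\<close>. The constant is chosen before
  the truncation, so it serves all orders.
\<close>

lemma ev_order_bound:
  assumes A: "geometric Q A" and Q: "Q > 0"
  obtains C where "C \<ge> 0" "\<And>B n x y. (\<And>k. fps_nth B k = (if k < n then 0 else fps_nth A k)) \<Longrightarrow>
      \<bar>x\<bar> < 1 / (2 * Q) \<Longrightarrow> \<bar>y\<bar> < 1 / (2 * Q) \<Longrightarrow> \<bar>ev B x y\<bar> \<le> C * (Q * \<bar>x\<bar>) ^ n"
proof -
  obtain M where M: "M \<ge> 0" "\<And>k y. \<bar>y\<bar> \<le> 1 / (2 * Q) \<Longrightarrow> \<bar>poly (fps_nth A k) y\<bar> \<le> M * Q ^ k"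
    using geometric_poly_bound[OF A Q] by blast
  have "\<bar>ev B x y\<bar> \<le> (2 * M) * (Q * \<bar>x\<bar>) ^ n"
    if B: "\<And>k. fps_nth B k = (if k < n then 0 else fps_nth A k)"
      and x: "\<bar>x\<bar> < 1 / (2 * Q)" and y: "\<bar>y\<bar> < 1 / (2 * Q)" for B n x y
  proof -
    define b where "b k = poly (fps_nth B k) y * x ^ k" for k
    have b0: "b k = 0" if "k < n" for k using that by (simp add: b_def B)
    have b: "\<bar>b (k + n)\<bar> \<le> M * (Q * \<bar>x\<bar>) ^ n * (1/2) ^ k" for k
    proof -
      have "\<bar>poly (fps_nth A (k + n)) y * x ^ n\<bar> \<le> (M * Q ^ (k + n)) * \<bar>x\<bar> ^ n"
        using M(2)[of y "k + n"] y by (simp add: abs_mult power_abs mult_right_mono)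
      also have "\<dots> = (M * (Q * \<bar>x\<bar>) ^ n) * Q ^ k" by (simp add: power_mult_distrib power_add)
      finally have "\<bar>(poly (fps_nth A (k + n)) y * x ^ n) * x ^ k\<bar> \<le> M * (Q * \<bar>x\<bar>) ^ n * (1/2) ^ k"
        by (rule geometric_term_bound) (use x Q M in auto)
      then show ?thesis by (simp add: b_def B power_add mult_ac)
    qed
    have geo: "(\<lambda>k. M * (Q * \<bar>x\<bar>) ^ n * (1/2) ^ k) sums (M * (Q * \<bar>x\<bar>) ^ n * 2)"
      using sums_mult[OF geometric_sums[of "1/2 :: real"]] by simp
    have s: "summable (\<lambda>k. \<bar>b (k + n)\<bar>)"
      by (rule summable_comparison_test'[OF sums_summable[OF geo], of 0]) (use b in auto)
    have "summable b"
      using summable_rabs_cancel[OF s] by (simp add: summable_iff_shift)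
    then have "suminf b = (\<Sum>k. b (k + n)) + (\<Sum>k<n. b k)"
      by (rule suminf_split_initial_segment)
    moreover have "ev B x y = suminf b"
      by (simp add: ev_def eval_fps_def b_def[abs_def])
    ultimately have "ev B x y = (\<Sum>k. b (k + n))"
      by (simp add: b0)
    also have "\<bar>\<dots>\<bar> \<le> (\<Sum>k. \<bar>b (k + n)\<bar>)" by (rule summable_rabs[OF s])
    also have "\<dots> \<le> (\<Sum>k. M * (Q * \<bar>x\<bar>) ^ n * (1/2) ^ k)"
      by (rule suminf_le[OF b s sums_summable[OF geo]])
    also have "\<dots> = (2 * M) * (Q * \<bar>x\<bar>) ^ n" using geo by (simp add: sums_iff)
    finally show ?thesis .
  qed
  then show ?thesis using M(1) that[of "2 * M"] by simp
qed

section \<open>Re-expansion of a double power series\<close>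

definition square :: "real \<Rightarrow> (real \<times> real) set" where
  "square \<rho> = {(x, y). \<bar>x\<bar> < \<rho> \<and> \<bar>y\<bar> < \<rho>}"

lemma mem_square [simp]: "(x, y) \<in> square \<rho> \<longleftrightarrow> \<bar>x\<bar> < \<rho> \<and> \<bar>y\<bar> < \<rho>"
  by (simp add: square_def)

lemma open_square: "open (square \<rho>)"
proof -
  have "square \<rho> = {-\<rho><..<\<rho>} \<times> {-\<rho><..<\<rho>}" by (auto simp: square_def)
  then show ?thesis by (simp add: open_Times)
qed

text \<open>
  The coefficient of \<open>s\<^sup>i t\<^sup>l\<close> in \<open>a\<^sub>k\<^sub>j (u + s)\<^sup>k (v + t)\<^sup>j\<close>.
\<close>

definition shifted_term :: "(nat \<Rightarrow> nat \<Rightarrow> real) \<Rightarrow> real \<Rightarrow> real \<Rightarrow> nat \<times> nat \<Rightarrow> nat \<times> nat \<Rightarrow> real" where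
  "shifted_term a u v = (\<lambda>(k, j) (i, l).
     a k j * (real (k choose i) * u ^ (k - i)) * (real (j choose l) * v ^ (j - l)))"

lemma has_sum_shifted_term:
  "((\<lambda>(i, l). shifted_term a u v (k, j) (i, l) * s ^ i * t ^ l)
      has_sum (a k j * (u + s) ^ k * (v + t) ^ j)) UNIV"
proof (rule has_sum_finite_neutralI)
  have "a k j * (u + s) ^ k * (v + t) ^ j = a k j * (s + u) ^ k * (t + v) ^ j"
    by (simp add: add.commute)
  also have "\<dots> = a k j * ((\<Sum>i\<le>k. real (k choose i) * s ^ i * u ^ (k - i)) *
      (\<Sum>l\<le>j. real (j choose l) * t ^ l * v ^ (j - l)))"
    by (simp only: binomial_ring mult.assoc)
  also have "\<dots> = (\<Sum>(i, l)\<in>{..k} \<times> {..j}. shifted_term a u v (k, j) (i, l) * s ^ i * t ^ l)"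
    unfolding sum_product sum.cartesian_product
    unfolding sum_distrib_left
    by (intro sum.cong refl) (auto simp: shifted_term_def)
  finally show "a k j * (u + s) ^ k * (v + t) ^ j
    = (\<Sum>(i, l)\<in>{..k} \<times> {..j}. shifted_term a u v (k, j) (i, l) * s ^ i * t ^ l)" .
qed (auto simp: shifted_term_def)

text \<open>
  Replacing everything by absolute values, the inner sums become the terms of the original series
  at the point \<open>(\<bar>u\<bar> + \<bar>s\<bar>, \<bar>v\<bar> + \<bar>t\<bar>)\<close>. This is why the expansion at a new centre converges in the
  largest square around it inside the square of convergence.
\<close>

lemma summable_on_shifted_term:
  fixes u v s t :: real
  assumes sum: "((\<lambda>(k, j). a k j * (\<bar>u\<bar> + \<bar>s\<bar>) ^ k * (\<bar>v\<bar> + \<bar>t\<bar>) ^ j) has_sum S) UNIV"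
  shows "(\<lambda>(p, (i, l)). shifted_term a u v p (i, l) * s ^ i * t ^ l) summable_on (UNIV \<times> UNIV)"
proof -
  let ?W = "\<lambda>(p, (i, l)). shifted_term a u v p (i, l) * s ^ i * t ^ l"
  let ?V = "\<lambda>(p, (i, l)). shifted_term (\<lambda>k j. \<bar>a k j\<bar>) \<bar>u\<bar> \<bar>v\<bar> p (i, l) * \<bar>s\<bar> ^ i * \<bar>t\<bar> ^ l"
  have "(\<lambda>(k, j). a k j * (\<bar>u\<bar> + \<bar>s\<bar>) ^ k * (\<bar>v\<bar> + \<bar>t\<bar>) ^ j) summable_on UNIV"
    using sum by (rule has_sum_imp_summable)
  then have "(\<lambda>p. \<bar>case p of (k, j) \<Rightarrow> a k j * (\<bar>u\<bar> + \<bar>s\<bar>) ^ k * (\<bar>v\<bar> + \<bar>t\<bar>) ^ j\<bar>) summable_on UNIV"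
    using summable_on_iff_abs_summable_on_real by force
  then have outer: "(\<lambda>(k, j). \<bar>a k j\<bar> * (\<bar>u\<bar> + \<bar>s\<bar>) ^ k * (\<bar>v\<bar> + \<bar>t\<bar>) ^ j) summable_on UNIV"
    by (simp add: case_prod_unfold abs_mult power_abs)
  have "?V summable_on (UNIV \<times> UNIV)"
  proof (rule summable_on_SigmaI[OF _ outer])
    fix p :: "nat \<times> nat"
    show "((\<lambda>q. ?V (p, q)) has_sum (case p of (k, j) \<Rightarrow> \<bar>a k j\<bar> * (\<bar>u\<bar> + \<bar>s\<bar>) ^ k * (\<bar>v\<bar> + \<bar>t\<bar>) ^ j)) UNIV"
      using has_sum_shifted_term[of "\<lambda>k j. \<bar>a k j\<bar>" "\<bar>u\<bar>" "\<bar>v\<bar>" "fst p" "snd p" "\<bar>s\<bar>" "\<bar>t\<bar>"]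
      by (simp add: case_prod_unfold)
  next
    fix p q :: "nat \<times> nat"
    show "0 \<le> ?V (p, q)"
      by (auto simp: shifted_term_def split: prod.split)
  qed
  then have "(\<lambda>z. norm (?W z)) summable_on (UNIV \<times> UNIV)"
    by (rule Infinite_Sum.abs_summable_on_comparison_test') (auto simp: shifted_term_def abs_mult power_abs)
  then show ?thesis by (rule abs_summable_summable)
qed

text \<open>
  Expand each monomial around the new centre and interchange the two double sums, which is
  justified by absolute summability of the fourfold family.
\<close>

lemma real_analytic2_on_square:
  assumes sum: "\<And>x y. \<bar>x\<bar> < \<rho> \<Longrightarrow> \<bar>y\<bar> < \<rho> \<Longrightarrow> ((\<lambda>(k, j). a k j * x ^ k * y ^ j) has_sum f x y) UNIV"
  shows "real_analytic2_on (square \<rho>) f"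
  unfolding real_analytic2_on_def
proof clarify
  fix x0 y0 :: real
  assume "(x0, y0) \<in> square \<rho>"
  then have x0: "\<bar>x0\<bar> < \<rho>" and y0: "\<bar>y0\<bar> < \<rho>" by auto
  define r where "r = min (\<rho> - \<bar>x0\<bar>) (\<rho> - \<bar>y0\<bar>)"
  have r: "r > 0" using x0 y0 by (simp add: r_def)
  let ?W = "\<lambda>s t (p, (i, l)). shifted_term a x0 y0 p (i, l) * s ^ i * t ^ l"
  have W: "?W s t summable_on (UNIV \<times> UNIV)" if "\<bar>s\<bar> < r" "\<bar>t\<bar> < r" for s t
    by (rule summable_on_shifted_term, rule sum) (use that in \<open>auto simp: r_def\<close>)
  have W': "(\<lambda>((i, l), p). shifted_term a x0 y0 p (i, l) * s ^ i * t ^ l) summable_on (UNIV \<times> UNIV)"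
    if "\<bar>s\<bar> < r" "\<bar>t\<bar> < r" for s t
    using W[OF that] by (subst (asm) summable_on_swap) (simp add: case_prod_unfold)
  define A where "A i l = infsum (\<lambda>p. shifted_term a x0 y0 p (i, l)) UNIV" for i l
  have A: "((\<lambda>p. shifted_term a x0 y0 p (i, l)) has_sum A i l) UNIV" for i l
  proof -
    \<comment> \<open>A displacement without zero components exhibits each coefficient as a convergent sum.\<close>
    have "(\<lambda>((i, l), p). shifted_term a x0 y0 p (i, l) * (r / 2) ^ i * (r / 2) ^ l) summable_on (UNIV \<times> UNIV)"
      using r by (intro W') auto
    from summable_on_SigmaD1[of "\<lambda>(i, l) p. shifted_term a x0 y0 p (i, l) * (r / 2) ^ i * (r / 2) ^ l",
        OF _ UNIV_I, of "\<lambda>_. UNIV" "(i, l)"] this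
    have "(\<lambda>p. shifted_term a x0 y0 p (i, l) * (r / 2) ^ i * (r / 2) ^ l) summable_on UNIV"
      by (simp add: case_prod_unfold)
    then have "(\<lambda>p. shifted_term a x0 y0 p (i, l)) summable_on UNIV"
      using r by (simp add: mult.assoc summable_on_cmult_left')
    then show ?thesis unfolding A_def by (rule has_sum_infsum)
  qed
  show "\<exists>A r. r > 0 \<and> (\<forall>x y. \<bar>x - x0\<bar> < r \<longrightarrow> \<bar>y - y0\<bar> < r \<longrightarrow>
      ((\<lambda>(i, j). A i j * (x - x0) ^ i * (y - y0) ^ j) has_sum f x y) UNIV)"
  proof (intro exI[of _ A] exI[of _ r] conjI allI impI r)
    fix x y :: real
    assume s: "\<bar>x - x0\<bar> < r" and t: "\<bar>y - y0\<bar> < r"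
    have "((\<lambda>(k, j). a k j * x ^ k * y ^ j) has_sum f x y) UNIV"
      by (rule sum) (use s t in \<open>auto simp: r_def\<close>)
    then have "(?W (x - x0) (y - y0) has_sum f x y) (UNIV \<times> UNIV)"
    proof (rule has_sum_SigmaI[rotated])
      fix p :: "nat \<times> nat"
      show "((\<lambda>q. ?W (x - x0) (y - y0) (p, q)) has_sum (case p of (k, j) \<Rightarrow> a k j * x ^ k * y ^ j)) UNIV"
        using has_sum_shifted_term[of a x0 y0 "fst p" "snd p" "x - x0" "y - y0"]
        by (simp add: case_prod_unfold)
    qed (rule W[OF s t])
    then have "((\<lambda>(q, p). ?W (x - x0) (y - y0) (p, q)) has_sum f x y) (UNIV \<times> UNIV)"
      by (subst (asm) has_sum_swap) (simp add: case_prod_unfold)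
    then show "((\<lambda>(i, j). A i j * (x - x0) ^ i * (y - y0) ^ j) has_sum f x y) UNIV"
    proof (rule has_sum_SigmaD)
      fix q :: "nat \<times> nat"
      show "((\<lambda>p. (\<lambda>(q, p). ?W (x - x0) (y - y0) (p, q)) (q, p)) has_sum
          (case q of (i, j) \<Rightarrow> A i j * (x - x0) ^ i * (y - y0) ^ j)) UNIV"
        by (cases q) (auto intro!: has_sum_cmult_left A)
    qed
  qed
qed

section \<open>The zero mean curvature graphs\<close>

definition graph_fps :: "real \<Rightarrow> real poly fps" where
  "graph_fps c = fps_const [:0, 1:] + zmc_fps c"

lemma fps_dy_one_plus: "fps_dy (1 + A) = fps_dy A"
  by (rule fps_ext) (simp add: pderiv_add fps_one_nth)

lemma graph_fps_deriv:
  "fps_deriv (graph_fps c) = fps_deriv (zmc_fps c)"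
  "fps_dy (graph_fps c) = 1 + fps_dy (zmc_fps c)"
  by (rule fps_ext; simp add: graph_fps_def pderiv_add pderiv_pCons fps_one_nth)+

text \<open>
  Substituting \<open>f\<^sub>y = 1 + g\<^sub>y\<close>, the left-hand side becomes the difference of the two sides of the
  equation for \<open>g\<close>.
\<close>

lemma graph_fps_zmc:
  fixes c :: real
  defines "F \<equiv> graph_fps c"
  defines "Fx \<equiv> fps_deriv F" and "Fy \<equiv> fps_dy F"
  defines "Fxx \<equiv> fps_deriv Fx" and "Fxy \<equiv> fps_dy Fx" and "Fyy \<equiv> fps_dy Fy"
  shows "(1 - Fy * Fy) * Fxx + (Fx * Fy * Fxy + Fx * Fy * Fxy) + (1 - Fx * Fx) * Fyy = 0"
proof -
  define Gx Gy Gxx Gxy Gyy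
    where G: "Gx = fps_deriv (zmc_fps c)" "Gy = fps_dy (zmc_fps c)"
      "Gxx = fps_deriv Gx" "Gxy = fps_dy Gx" "Gyy = fps_dy Gy"
  have F: "Fx = Gx" "Fy = 1 + Gy" "Fxx = Gxx" "Fxy = Gxy" "Fyy = Gyy"
    unfolding Fx_def Fy_def Fxx_def Fxy_def Fyy_def F_def G
    by (simp_all only: graph_fps_deriv fps_dy_one_plus)
  have "(1 - Fy * Fy) * Fxx + (Fx * Fy * Fxy + Fx * Fy * Fxy) + (1 - Fx * Fx) * Fyy
    = Gyy - (2 * (Gy * Gxx) - 2 * (Gx * Gxy) + Gy * (Gy * Gxx) - 2 * (Gy * (Gxy * Gx))
      + Gx * (Gx * Gyy))"
    unfolding F by (simp add: algebra_simps)
  also have "\<dots> = 0"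
    using zmc_fps_pde[of c] unfolding G by simp
  finally show ?thesis .
qed

text \<open>
  One \<open>Q\<close> for \<open>f\<close>, its partial derivatives up to order two, and \<open>f\<^sub>y - 1\<close>: all of them are then
  evaluated on the same square.
\<close>

definition graph_radius :: "real \<Rightarrow> real \<Rightarrow> bool" where
  "graph_radius c Q \<longleftrightarrow> Q > 0 \<and> (\<forall>A \<in> {graph_fps c, fps_deriv (graph_fps c), fps_dy (graph_fps c),
     fps_deriv (fps_deriv (graph_fps c)), fps_dy (fps_deriv (graph_fps c)),
     fps_dy (fps_dy (graph_fps c)), fps_dy (zmc_fps c)}. geometric Q A)"

lemma ex_graph_radius: "\<exists>Q. graph_radius c Q"
proof -
  obtain Q where Q: "Q > 0" "\<And>k j. \<bar>coeff (fps_nth (zmc_fps c) k) j\<bar> \<le> Q ^ (k + j)"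
    using zmc_fps_geometric_bound by blast
  have G: "geometric Q (zmc_fps c)"
    unfolding geometric_def using Q(2) by (intro exI[of _ 1]) (simp del: zmc_fps_nth)
  have "\<bar>coeff (fps_nth (fps_const [:0, 1 :: real:]) k) j\<bar> \<le> 1 / Q * Q ^ (k + j)" for k j
    using Q(1) by (cases "k = 0 \<and> j = 1") (auto simp: coeff_pCons split: nat.splits)
  then have "geometric Q (fps_const [:0, 1:])"
    unfolding geometric_def by blast
  then have F: "geometric Q (graph_fps c)"
    unfolding graph_fps_def using G by (rule geometric_add)
  have first: "geometric (2 * Q) (fps_deriv (graph_fps c))" "geometric (2 * Q) (fps_dy (graph_fps c))"
    "geometric (2 * Q) (fps_dy (zmc_fps c))"
    using F G Q(1) by (auto intro: geometric_fps_deriv geometric_fps_dy)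
  have second: "geometric (2 * (2 * Q)) (fps_deriv (fps_deriv (graph_fps c)))"
    "geometric (2 * (2 * Q)) (fps_dy (fps_deriv (graph_fps c)))"
    "geometric (2 * (2 * Q)) (fps_dy (fps_dy (graph_fps c)))"
    using geometric_fps_deriv[OF first(1)] geometric_fps_dy[OF first(1)] geometric_fps_dy[OF first(2)] Q(1)
    by auto
  have "graph_radius c (2 * (2 * Q))"
    unfolding graph_radius_def using Q(1) second F first
    by (auto intro: geometric_mono[where Q = Q] geometric_mono[where Q = "2 * Q"])
  then show ?thesis by blast
qed

lemma graph_fps_base:
  "fps_nth (graph_fps c) 0 = [:0, 1:]" "fps_nth (graph_fps c) 1 = 0"
  "fps_nth (graph_fps c) 2 = 0" "fps_nth (graph_fps c) 3 = [:0, c:]"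
  using zmc_poly_base[of c] by (simp_all add: graph_fps_def)

lemma zmc_fps_base:
  "fps_nth (zmc_fps c) 0 = 0" "fps_nth (zmc_fps c) 1 = 0"
  "fps_nth (zmc_fps c) 2 = 0" "fps_nth (zmc_fps c) 3 = [:0, c:]"
  using zmc_poly_base[of c] by simp_all

lemma zmc_tail_eq: "zmc_tail c x y k = poly (fps_nth (graph_fps c) (k + 4)) y * x ^ (k + 4)"
  by (simp add: zmc_tail_def zmc_coeff_eq graph_fps_def field_simps)

context
  fixes c Q :: real
  assumes radius: "graph_radius c Q"
begin

lemma Q_pos: "Q > 0"
  using radius by (simp add: graph_radius_def)

lemma geometric_graph:
  "geometric Q (graph_fps c)" "geometric Q (fps_deriv (graph_fps c))" "geometric Q (fps_dy (graph_fps c))"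
  "geometric Q (fps_deriv (fps_deriv (graph_fps c)))" "geometric Q (fps_dy (fps_deriv (graph_fps c)))"
  "geometric Q (fps_dy (fps_dy (graph_fps c)))" "geometric Q (fps_dy (zmc_fps c))"
  using radius by (simp_all add: graph_radius_def)

lemma zmc_series_converges:
  assumes "(x, y) \<in> square (1 / (2 * Q))"
  shows "summable (zmc_tail c x y)" "zmc_series c x y = ev (graph_fps c) x y"
proof -
  define b where "b k = poly (fps_nth (graph_fps c) k) y * x ^ k" for k
  have "summable (\<lambda>k. \<bar>b k\<bar>)"
    unfolding b_def by (rule geometric_summable[OF geometric_graph(1) Q_pos]) (use assms in auto)
  then have b: "summable b" by (rule summable_rabs_cancel)
  have tail: "zmc_tail c x y = (\<lambda>k. b (k + 4))"
    by (simp add: fun_eq_iff zmc_tail_eq b_def)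
  show "summable (zmc_tail c x y)"
    unfolding tail using b by (simp add: summable_iff_shift)
  have "ev (graph_fps c) x y = suminf b"
    by (simp add: ev_def eval_fps_def b_def[abs_def])
  also have "\<dots> = (\<Sum>k. b (k + 4)) + (\<Sum>k<4. b k)"
    using b by (rule suminf_split_initial_segment)
  also have "(\<Sum>k<4. b k) = y + c * y * x ^ 3"
    using graph_fps_base[of c] by (simp add: numeral_eq_Suc b_def)
  finally show "zmc_series c x y = ev (graph_fps c) x y"
    by (simp add: zmc_series_def tail)
qed

lemma converges_graph:
  assumes "(x, y) \<in> square (1 / (2 * Q))" "geometric Q A"
  shows "converges_at A x y"
  by (rule geometric_converges_at[OF assms(2) Q_pos]) (use assms(1) in auto)

lemma pdx_graph:
  assumes "(x, y) \<in> square (1 / (2 * Q))" "geometric Q A"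
    and f: "\<And>x y. (x, y) \<in> square (1 / (2 * Q)) \<Longrightarrow> f x y = ev A x y"
  shows "pdx f x y = ev (fps_deriv A) x y"
  using pdx_cong[OF open_square assms(1) f] pdx_ev[OF converges_graph[OF assms(1,2)]] by simp

lemma pdy_graph:
  assumes xy: "(x, y) \<in> square (1 / (2 * Q))" and A: "geometric Q A" "geometric Q (fps_dy A)"
    and f: "\<And>x y. (x, y) \<in> square (1 / (2 * Q)) \<Longrightarrow> f x y = ev A x y"
  shows "pdy f x y = ev (fps_dy A) x y"
  using pdy_cong[OF open_square xy f] pdy_ev[OF A Q_pos, of x y] xy by simp

lemma graph_partials:
  assumes "(x, y) \<in> square (1 / (2 * Q))"
  shows "pdx (zmc_series c) x y = ev (fps_deriv (graph_fps c)) x y"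
    "pdy (zmc_series c) x y = ev (fps_dy (graph_fps c)) x y"
  by (rule pdx_graph[OF assms geometric_graph(1) zmc_series_converges(2)], assumption)
    (rule pdy_graph[OF assms geometric_graph(1,3) zmc_series_converges(2)], assumption)

lemma graph_second_partials:
  assumes "(x, y) \<in> square (1 / (2 * Q))"
  shows "pdx (pdx (zmc_series c)) x y = ev (fps_deriv (fps_deriv (graph_fps c))) x y"
    "pdy (pdx (zmc_series c)) x y = ev (fps_dy (fps_deriv (graph_fps c))) x y"
    "pdy (pdy (zmc_series c)) x y = ev (fps_dy (fps_dy (graph_fps c))) x y"
  by (rule pdx_graph[OF assms geometric_graph(2) graph_partials(1)], assumption)
    (rule pdy_graph[OF assms geometric_graph(2,5) graph_partials(1)]
      pdy_graph[OF assms geometric_graph(3,6) graph_partials(2)], assumption)+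

text \<open>
  Evaluation is a ring homomorphism at points of convergence and commutes with the partial
  derivatives, so the formal equation becomes an equation between functions.
\<close>

lemma analytic_zmc_graph_square:
  assumes "\<delta> \<le> 1 / (2 * Q)"
  shows "analytic_zmc_graph (square \<delta>) (zmc_series c)"
  unfolding analytic_zmc_graph_def
proof (intro conjI open_square)
  show "real_analytic2_on (square \<delta>) (zmc_series c)"
  proof (rule real_analytic2_on_square)
    fix x y :: real
    assume "\<bar>x\<bar> < \<delta>" "\<bar>y\<bar> < \<delta>"
    then show "((\<lambda>(k, j). coeff (fps_nth (graph_fps c) k) j * x ^ k * y ^ j) has_sum zmc_series c x y) UNIV"
      using geometric_has_sum[OF geometric_graph(1) Q_pos, of x y] zmc_series_converges(2)[of x y] assms
      by auto
  qed
  show "\<forall>(x, y)\<in>square \<delta>.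
      (1 - (pdy (zmc_series c) x y)\<^sup>2) * pdx (pdx (zmc_series c)) x y
      + 2 * pdx (zmc_series c) x y * pdy (zmc_series c) x y * pdy (pdx (zmc_series c)) x y
      + (1 - (pdx (zmc_series c) x y)\<^sup>2) * pdy (pdy (zmc_series c)) x y = 0"
  proof clarify
    fix x y :: real
    assume "(x, y) \<in> square \<delta>"
    then have xy: "(x, y) \<in> square (1 / (2 * Q))" using assms by auto
    note conv = converges_graph[OF xy, OF geometric_graph(2)] converges_graph[OF xy, OF geometric_graph(3)]
      converges_graph[OF xy, OF geometric_graph(4)] converges_graph[OF xy, OF geometric_graph(5)]
      converges_graph[OF xy, OF geometric_graph(6)]
    have "ev 0 x y = 0" by (simp add: ev_def fps_at_def fps_zero_def[symmetric])
    moreover note arg_cong[OF graph_fps_zmc[of c], of "\<lambda>A. ev A x y"]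
    ultimately show "(1 - (pdy (zmc_series c) x y)\<^sup>2) * pdx (pdx (zmc_series c)) x y
      + 2 * pdx (zmc_series c) x y * pdy (zmc_series c) x y * pdy (pdx (zmc_series c)) x y
      + (1 - (pdx (zmc_series c) x y)\<^sup>2) * pdy (pdy (zmc_series c)) x y = 0"
      unfolding graph_partials[OF xy] graph_second_partials[OF xy]
      by (simp only: ev_add ev_diff ev_mult ev_1 conv power2_eq_square mult_2 distrib_right)
  qed
qed

end

lemma ev_monomial:
  "converges_at (fps_const p * fps_X ^ n) x y" "ev (fps_const p * fps_X ^ n) x y = poly p y * x ^ n"
proof -
  have at: "fps_at (fps_const p * fps_X ^ n) y = fps_const (poly p y) * fps_X ^ n"
    by (rule fps_ext) (simp add: fps_X_power_mult_right_nth)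
  have "min \<infinity> \<infinity> \<le> fps_conv_radius (fps_const (poly p y) * fps_X ^ n)"
    using fps_conv_radius_mult[of "fps_const (poly p y)" "fps_X ^ n"] by simp
  then show "converges_at (fps_const p * fps_X ^ n) x y"
    unfolding converges_at_def at by simp
  show "ev (fps_const p * fps_X ^ n) x y = poly p y * x ^ n"
    unfolding ev_def at by (subst eval_fps_mult) simp_all
qed

text \<open>
  With \<open>f = y + g\<close>, the function is \<open>- 2 g\<^sub>y - g\<^sub>y\<^sup>2 - g\<^sub>x\<^sup>2\<close>. Here \<open>g\<^sub>y = c x\<^sup>3 + O(x\<^sup>4)\<close> and
  \<open>g\<^sub>x = O(x\<^sup>2)\<close>, so only the first term contributes to order three.
\<close>

lemma type_function_asymptotics:
  assumes radius: "graph_radius c Q"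
  obtains D where "D \<ge> 0" "\<And>x y. (x, y) \<in> square (1 / (2 * Q)) \<Longrightarrow>
    \<bar>1 - (pdx (zmc_series c) x y)\<^sup>2 - (pdy (zmc_series c) x y)\<^sup>2 + 2 * c * x ^ 3\<bar> \<le> D * x ^ 4"
proof -
  define Gx Gy where "Gx = fps_deriv (graph_fps c)" and "Gy = fps_dy (zmc_fps c)"
  define B where "B = Abs_fps (\<lambda>k. if k < 4 then 0 else fps_nth Gy k)"
  note Q = Q_pos[OF radius]
  have Gx: "fps_nth Gx k = (if k < 2 then 0 else fps_nth Gx k)" for k
  proof -
    consider "k = 0" | "k = 1" | "\<not> k < 2" by linarith
    then show ?thesis using zmc_poly_base[of c]
      by cases (auto simp: Gx_def graph_fps_deriv numeral_2_eq_2)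
  qed
  have Gy: "fps_nth Gy k = (if k < 3 then 0 else fps_nth Gy k)" for k
  proof -
    consider "k = 0" | "k = 1" | "k = 2" | "\<not> k < 3" by linarith
    then show ?thesis using zmc_poly_base[of c] by cases (auto simp: Gy_def)
  qed
  have B: "fps_nth B k = (if k < 4 then 0 else fps_nth Gy k)" for k
    by (simp add: B_def)
  have Gy_B: "Gy = B + fps_const [:c:] * fps_X ^ 3"
  proof (rule fps_ext)
    fix k :: nat
    consider "k < 3" | "k = 3" | "k > 3" by linarith
    then show "fps_nth Gy k = fps_nth (B + fps_const [:c:] * fps_X ^ 3) k"
    proof cases
      case 1
      then show ?thesis using Gy[of k] by (simp add: B)
    next
      case 2
      then show ?thesis using zmc_fps_base(4)[of c] by (simp add: B Gy_def pderiv_pCons del: zmc_fps_nth)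
    qed (auto simp: B)
  qed
  have geo: "geometric Q Gx" "geometric Q Gy"
    using geometric_graph[OF radius] by (auto simp: Gx_def Gy_def)
  obtain M where M: "M \<ge> 0" "\<And>k j. \<bar>coeff (fps_nth Gy k) j\<bar> \<le> M * Q ^ (k + j)"
    using geometricE[OF geo(2)] by blast
  have "\<bar>coeff (fps_nth B k) j\<bar> \<le> M * Q ^ (k + j)" for k j
    using M(2)[of k j] M(1) Q by (cases "k < 4") (simp_all add: B)
  then have geo_B: "geometric Q B"
    unfolding geometric_def by blast
  obtain Cx where Cx: "Cx \<ge> 0" "\<And>B n x y. (\<And>k. fps_nth B k = (if k < n then 0 else fps_nth Gx k)) \<Longrightarrow>
      \<bar>x\<bar> < 1 / (2 * Q) \<Longrightarrow> \<bar>y\<bar> < 1 / (2 * Q) \<Longrightarrow> \<bar>ev B x y\<bar> \<le> Cx * (Q * \<bar>x\<bar>) ^ n"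
    using ev_order_bound[OF geo(1) Q] by blast
  obtain Cy where Cy: "Cy \<ge> 0" "\<And>B n x y. (\<And>k. fps_nth B k = (if k < n then 0 else fps_nth Gy k)) \<Longrightarrow>
      \<bar>x\<bar> < 1 / (2 * Q) \<Longrightarrow> \<bar>y\<bar> < 1 / (2 * Q) \<Longrightarrow> \<bar>ev B x y\<bar> \<le> Cy * (Q * \<bar>x\<bar>) ^ n"
    using ev_order_bound[OF geo(2) Q] by blast
  define D where "D = (2 * Cy + Cy\<^sup>2 + Cx\<^sup>2) * Q ^ 4"
  have "\<bar>1 - (pdx (zmc_series c) x y)\<^sup>2 - (pdy (zmc_series c) x y)\<^sup>2 + 2 * c * x ^ 3\<bar> \<le> D * x ^ 4"
    if xy: "(x, y) \<in> square (1 / (2 * Q))" for x y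
  proof -
    define gx gy e where "gx = ev Gx x y" and "gy = ev Gy x y" and "e = ev B x y"
    define z where "z = Q * \<bar>x\<bar>"
    have lt: "\<bar>x\<bar> < 1 / (2 * Q)" "\<bar>y\<bar> < 1 / (2 * Q)" using xy by auto
    have z: "0 \<le> z" "z \<le> 1" using lt(1) Q by (auto simp: z_def field_simps)
    have fx: "pdx (zmc_series c) x y = gx"
      by (simp add: graph_partials[OF radius xy] gx_def Gx_def)
    have fy: "pdy (zmc_series c) x y = 1 + gy"
      using ev_add(2)[OF ev_1(1) converges_graph[OF radius xy geo(2)]]
      by (simp add: graph_partials[OF radius xy] gy_def Gy_def graph_fps_deriv ev_1)
    have gy: "gy = e + c * x ^ 3"
      unfolding gy_def e_def Gy_B
      using ev_add(2)[OF converges_graph[OF radius xy geo_B] ev_monomial(1)] by (simp add: ev_monomial)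
    have bounds: "\<bar>e\<bar> \<le> Cy * z ^ 4" "\<bar>gy\<bar> \<le> Cy * z ^ 3" "\<bar>gx\<bar> \<le> Cx * z ^ 2"
      unfolding e_def gy_def gx_def z_def using Cy(2)[OF B lt] Cy(2)[OF Gy lt] Cx(2)[OF Gx lt] by auto
    have "gy\<^sup>2 \<le> (Cy * z ^ 3)\<^sup>2"
      using bounds(2) Cy(1) z by (simp add: abs_le_square_iff[symmetric])
    also have "\<dots> = Cy\<^sup>2 * z ^ 6" by (simp add: power_mult_distrib flip: power_mult)
    also have "\<dots> \<le> Cy\<^sup>2 * z ^ 4" using z by (intro mult_left_mono power_decreasing) auto
    finally have gy2: "gy\<^sup>2 \<le> Cy\<^sup>2 * z ^ 4" .
    have "gx\<^sup>2 \<le> (Cx * z ^ 2)\<^sup>2"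
      using bounds(3) Cx(1) z by (simp add: abs_le_square_iff[symmetric])
    then have gx2: "gx\<^sup>2 \<le> Cx\<^sup>2 * z ^ 4" by (simp add: power_mult_distrib flip: power_mult)
    have "1 - gx\<^sup>2 - (1 + gy)\<^sup>2 + 2 * c * x ^ 3 = - 2 * e - gy\<^sup>2 - gx\<^sup>2"
      unfolding gy by (simp add: power2_eq_square algebra_simps)
    also have "\<bar>\<dots>\<bar> \<le> 2 * \<bar>e\<bar> + gy\<^sup>2 + gx\<^sup>2"
      using zero_le_power2[of gy] zero_le_power2[of gx] by linarith
    also have "\<dots> \<le> (2 * Cy + Cy\<^sup>2 + Cx\<^sup>2) * z ^ 4"
      using bounds(1) gy2 gx2 by (simp add: algebra_simps)
    also have "\<dots> = D * x ^ 4"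
      by (simp add: D_def z_def power_mult_distrib)
    finally show ?thesis unfolding fx fy .
  qed
  moreover have "D \<ge> 0" using Cy(1) by (simp add: D_def)
  ultimately show ?thesis by (rule that[rotated])
qed

text \<open>
  On the line \<open>y = 0\<close> the initial conditions \<open>b\<^sub>k'(0) = 0\<close> for \<open>k \<ge> 4\<close> leave only the cubic term,
  from which \<open>c\<close> can be read off.
\<close>

lemma pdy_zmc_series_axis:
  assumes radius: "graph_radius c Q" and x: "\<bar>x\<bar> < 1 / (2 * Q)"
  shows "pdy (zmc_series c) x 0 = 1 + c * x ^ 3"
proof -
  have xy: "(x, 0) \<in> square (1 / (2 * Q))" using x Q_pos[OF radius] by simp
  have "fps_at (fps_dy (zmc_fps c)) 0 = fps_at (fps_const [:c:] * fps_X ^ 3) 0"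
    by (rule fps_ext) (simp add: poly_0_coeff_0 coeff_pderiv coeff_zmc_poly[unfolded One_nat_def]
        fps_X_power_mult_right_nth)
  then have "ev (fps_dy (zmc_fps c)) x 0 = c * x ^ 3"
    using ev_monomial(2)[of "[:c:]" 3 x 0] by (simp add: ev_def)
  then show ?thesis
    using ev_add(2)[OF ev_1(1) converges_graph[OF radius xy geometric_graph(7)[OF radius]]]
    by (simp add: graph_partials[OF radius xy] graph_fps_deriv ev_1)
qed

lemma changes_type_square:
  assumes \<delta>: "\<delta> > 0"
    and space: "\<And>x y. (x, y) \<in> square \<delta> \<Longrightarrow> x < 0 \<Longrightarrow> spacelike_at (zmc_series c) x y"
    and time: "\<And>x y. (x, y) \<in> square \<delta> \<Longrightarrow> x > 0 \<Longrightarrow> timelike_at (zmc_series c) x y"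
  shows "changes_type_across {(t, x, y). t = y \<and> x = 0} (0, 0, 0) (square \<delta>) (zmc_series c)"
  unfolding changes_type_across_def
proof (intro exI[of _ "(1, 0, 1)"] conjI)
  show "null_vector (1, 0, 1)" by (simp add: null_vector_def lorentz_def zero_prod_def)
  have "(0, 0, 0) + s *\<^sub>R (1, 0, 1) = (s, 0 :: real, s)" for s :: real
    by (simp add: scaleR_Pair)
  then show "{(t, x, y). t = y \<and> x = 0} = {(0, 0, 0) + s *\<^sub>R (1, 0, 1 :: real) | s. True}"
    by auto
  show "\<exists>\<epsilon>>0. \<exists>V. open V \<and> V \<subseteq> square \<delta> \<and>
      (\<forall>s. \<bar>s\<bar> < \<epsilon> \<longrightarrow> (0, 0, 0) + s *\<^sub>R (1, 0, 1) \<in> graph_over V (zmc_series c)) \<and>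
      (\<forall>(x, y)\<in>V.
        (det2 (snd (1, 0, 1)) ((x, y) - snd (0, 0, 0)) > 0 \<longrightarrow> spacelike_at (zmc_series c) x y) \<and>
        (det2 (snd (1, 0, 1)) ((x, y) - snd (0, 0, 0)) < 0 \<longrightarrow> timelike_at (zmc_series c) x y))"
  proof (intro exI[of _ \<delta>] exI[of _ "square \<delta>"] conjI \<delta> open_square allI impI)
    fix s :: real assume "\<bar>s\<bar> < \<delta>"
    moreover have "zmc_tail c 0 s = (\<lambda>_. 0)" by (simp add: fun_eq_iff zmc_tail_def)
    ultimately show "(0, 0, 0) + s *\<^sub>R (1, 0, 1) \<in> graph_over (square \<delta>) (zmc_series c)"
      using \<delta> by (auto simp: graph_over_def scaleR_Pair zmc_series_def)
  qed (use space time in \<open>auto simp: det2_def\<close>)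
qed

lemma zmc_graph_near_origin:
  assumes "c > 0"
  shows "\<exists>\<delta>>0. (\<forall>(x, y)\<in>square \<delta>. summable (zmc_tail c x y)) \<and>
    analytic_zmc_graph (square \<delta>) (zmc_series c) \<and>
    changes_type_across {(t, x, y). t = y \<and> x = 0} (0, 0, 0) (square \<delta>) (zmc_series c) \<and>
    (\<forall>x. \<bar>x\<bar> < \<delta> \<longrightarrow> pdy (zmc_series c) x 0 = 1 + c * x ^ 3)"
proof -
  obtain Q where radius: "graph_radius c Q" using ex_graph_radius by blast
  obtain D where D: "D \<ge> 0" "\<And>x y. (x, y) \<in> square (1 / (2 * Q)) \<Longrightarrow>
    \<bar>1 - (pdx (zmc_series c) x y)\<^sup>2 - (pdy (zmc_series c) x y)\<^sup>2 + 2 * c * x ^ 3\<bar> \<le> D * x ^ 4"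
    using type_function_asymptotics[OF radius] by blast
  \<comment> \<open>The second bound makes \<open>D x\<^sup>4\<close> smaller than \<open>2 c \<bar>x\<bar>\<^sup>3\<close>, so the cubic term decides the sign.\<close>
  define \<delta> where "\<delta> = min (1 / (2 * Q)) (2 * c / (D + 1))"
  have \<delta>: "\<delta> > 0" "\<delta> \<le> 1 / (2 * Q)"
    using assms D(1) Q_pos[OF radius] by (auto simp: \<delta>_def)
  have \<delta>': "\<delta> * (D + 1) \<le> 2 * c"
  proof -
    have "\<delta> \<le> 2 * c / (D + 1)" by (simp add: \<delta>_def)
    then show ?thesis using D(1) by (simp add: le_divide_eq)
  qed
  have sub: "(x, y) \<in> square (1 / (2 * Q))" if "(x, y) \<in> square \<delta>" for x y
    using that \<delta>(2) by auto
  have small: "D * x ^ 4 < 2 * c * \<bar>x\<bar> ^ 3" if "(x, y) \<in> square \<delta>" "x \<noteq> 0" for x y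
  proof -
    have "D * \<bar>x\<bar> \<le> D * \<delta>" using that D(1) by (intro mult_left_mono) auto
    also have "\<dots> < 2 * c" using \<delta>(1) \<delta>' by (simp add: algebra_simps)
    finally have "(D * \<bar>x\<bar>) * \<bar>x\<bar> ^ 3 < 2 * c * \<bar>x\<bar> ^ 3"
      using that(2) by (intro mult_strict_right_mono) auto
    moreover have "\<bar>x\<bar> * \<bar>x\<bar> ^ 3 = x ^ 4"
      by (cases "x \<ge> 0") (simp_all add: eval_nat_numeral)
    ultimately show ?thesis by (simp add: mult.assoc)
  qed
  show ?thesis
  proof (intro exI[of _ \<delta>] conjI \<delta>(1) analytic_zmc_graph_square[OF radius \<delta>(2)])
    show "\<forall>(x, y)\<in>square \<delta>. summable (zmc_tail c x y)"
      using zmc_series_converges(1)[OF radius] sub by blast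
    show "\<forall>x. \<bar>x\<bar> < \<delta> \<longrightarrow> pdy (zmc_series c) x 0 = 1 + c * x ^ 3"
      using pdy_zmc_series_axis[OF radius] \<delta>(2) by auto
    show "changes_type_across {(t, x, y). t = y \<and> x = 0} (0, 0, 0) (square \<delta>) (zmc_series c)"
    proof (rule changes_type_square[OF \<delta>(1)])
      fix x y :: real
      assume xy: "(x, y) \<in> square \<delta>"
      show "spacelike_at (zmc_series c) x y" if "x < 0"
      proof -
        have "\<bar>x\<bar> ^ 3 = - (x ^ 3)" using that by (simp add: power3_eq_cube)
        then show ?thesis
          using D(2)[OF sub[OF xy]] small[OF xy] that by (simp add: spacelike_at_def)
      qed
      show "timelike_at (zmc_series c) x y" if "x > 0"
        using D(2)[OF sub[OF xy]] small[OF xy] that by (simp add: timelike_at_def)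
    qed
  qed
qed

text \<open>
  If the functions agreed on a neighbourhood of the origin, so would their slopes
  \<open>1 + c x\<^sup>3\<close> and \<open>1 + c' x\<^sup>3\<close> at some point \<open>(x, 0)\<close> with \<open>x \<noteq> 0\<close>.
\<close>

lemma zmc_series_neq:
  assumes pd: "\<And>x. \<bar>x\<bar> < \<delta> \<Longrightarrow> pdy (zmc_series c) x 0 = 1 + c * x ^ 3"
    "\<And>x. \<bar>x\<bar> < \<delta>' \<Longrightarrow> pdy (zmc_series c') x 0 = 1 + c' * x ^ 3"
    and "\<delta> > 0" "\<delta>' > 0" "c \<noteq> c'" "open N" "(0, 0) \<in> N"
  shows "\<exists>(x, y)\<in>N \<inter> square \<delta> \<inter> square \<delta>'. zmc_series c x y \<noteq> zmc_series c' x y"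
proof (rule ccontr)
  define W where "W = N \<inter> square \<delta> \<inter> square \<delta>'"
  assume "\<not> ?thesis"
  then have eq: "zmc_series c x y = zmc_series c' x y" if "(x, y) \<in> W" for x y
    using that by (auto simp: W_def)
  have W: "open W" "(0, 0) \<in> W"
    using assms by (auto simp: W_def intro!: open_Int open_square)
  then obtain e where e: "e > 0" "ball (0, 0) e \<subseteq> W"
    by (auto simp: open_contains_ball)
  have xW: "(e / 2, 0) \<in> W"
    using e by (intro subsetD[OF e(2)]) (auto simp: dist_Pair_Pair)
  have "pdy (zmc_series c) (e / 2) 0 = pdy (zmc_series c') (e / 2) 0"
    by (rule pdy_cong[OF W(1) xW eq])
  then show False using pd(1)[of "e / 2"] pd(2)[of "e / 2"] xW e(1) assms(5) by (auto simp: W_def)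
qed

theorem theorem1p1:
  shows
    "(\<forall>c>0. (\<exists>!b. zmc_recursion c b) \<and>
        (\<exists>U. open U \<and> (0, 0) \<in> U \<and>
           (\<forall>(x, y)\<in>U. summable (zmc_tail c x y)) \<and>
           analytic_zmc_graph U (zmc_series c)))
     \<and>
     (\<exists>U :: real \<Rightarrow> (real \<times> real) set.
        (\<forall>c>0. (0, 0) \<in> U c \<and>
           (\<forall>(x, y)\<in>U c. summable (zmc_tail c x y)) \<and>
           analytic_zmc_graph (U c) (zmc_series c) \<and>
           changes_type_across {(t, x, y). t = y \<and> x = 0} (0, 0, 0) (U c) (zmc_series c)) \<and>
        (\<forall>c>0. \<forall>c'>0. c \<noteq> c' \<longrightarrow>
           (\<forall>N. open N \<longrightarrow> (0, 0) \<in> N \<longrightarrow>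
              (\<exists>(x, y)\<in>N \<inter> U c \<inter> U c'. zmc_series c x y \<noteq> zmc_series c' x y))))"
proof -
  have "\<forall>c\<in>{0<..}. \<exists>\<delta>>0. (\<forall>(x, y)\<in>square \<delta>. summable (zmc_tail c x y)) \<and>
    analytic_zmc_graph (square \<delta>) (zmc_series c) \<and>
    changes_type_across {(t, x, y). t = y \<and> x = 0} (0, 0, 0) (square \<delta>) (zmc_series c) \<and>
    (\<forall>x. \<bar>x\<bar> < \<delta> \<longrightarrow> pdy (zmc_series c) x 0 = 1 + c * x ^ 3)"
    using zmc_graph_near_origin by blast
  then obtain \<delta> where \<delta>: "\<forall>c\<in>{0<..}. \<delta> c > 0 \<and> (\<forall>(x, y)\<in>square (\<delta> c). summable (zmc_tail c x y)) \<and>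
    analytic_zmc_graph (square (\<delta> c)) (zmc_series c) \<and>
    changes_type_across {(t, x, y). t = y \<and> x = 0} (0, 0, 0) (square (\<delta> c)) (zmc_series c) \<and>
    (\<forall>x. \<bar>x\<bar> < \<delta> c \<longrightarrow> pdy (zmc_series c) x 0 = 1 + c * x ^ 3)"
    by (rule bchoice[THEN exE])
  have unique: "\<exists>!b. zmc_recursion c b" for c
    using zmc_recursion_zmc_poly zmc_recursion_unique by blast
  show ?thesis
  proof (intro conjI allI impI exI[of _ "\<lambda>c. square (\<delta> c)"] unique)
    fix c :: real assume c: "c > 0"
    then show "\<exists>U. open U \<and> (0, 0) \<in> U \<and> (\<forall>(x, y)\<in>U. summable (zmc_tail c x y)) \<and>
        analytic_zmc_graph U (zmc_series c)"
      using \<delta> open_square[of "\<delta> c"] by (intro exI[of _ "square (\<delta> c)"]) auto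
    show "(0, 0) \<in> square (\<delta> c)" using \<delta> c by simp
    show "\<forall>(x, y)\<in>square (\<delta> c). summable (zmc_tail c x y)"
      "analytic_zmc_graph (square (\<delta> c)) (zmc_series c)"
      "changes_type_across {(t, x, y). t = y \<and> x = 0} (0, 0, 0) (square (\<delta> c)) (zmc_series c)"
      using \<delta> c by blast+
  next
    fix c c' :: real and N :: "(real \<times> real) set"
    assume "c > 0" "c' > 0" "c \<noteq> c'" "open N" "(0, 0) \<in> N"
    then show "\<exists>(x, y)\<in>N \<inter> square (\<delta> c) \<inter> square (\<delta> c'). zmc_series c x y \<noteq> zmc_series c' x y"
      using \<delta> by (intro zmc_series_neq) auto
  qed
qed

end
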